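(* Let $k\ge1$ and $\mathcal H=\mathbb C^{2^k}=(\mathbb C^2)^{\otimes k}$. Let $S=S^*\subset\mathbb B(\mathcal H)$ generate a Hörmander system for $\mathfrak{su}(2^k)$, and suppose $|0\rangle\langle 1|\otimes I^{\otimes(k-1)}\in S$ and $Z\otimes I^{\otimes(k-1)}\in S$. Then $\overline{\mathrm{Channel}(S)}$ is transitive.
   Context: $\mathbb B(\mathcal H)$ is the algebra of linear operators on $\mathcal H$; $\mathcal D(\mathcal H)=\{\rho\in\mathbb B(\mathcal H):\rho=\rho^*,\rho\ge 0,\mathrm{tr}\,\rho=1\}$ is the set of states. $|0\rangle,|1\rangle$ is the standard basis of $\mathbb C^2$, $I$ the identity on $\mathbb C^2$, $Z=\mathrm{diag}(1,-1)$ the Pauli matrix. $S^*=\{s^*:s\in S\}$. All spans are complex linear spans. Hörmander system: a set of anti-Hermitian operators on a $d$-dimensional space whose iterated commutators span $\mathfrak{su}(d)$. A resource set $S$ that also contains non-anti-Hermitian operators is said to be (generate) a Hörmander system if the real Lie algebra generated by the anti-Hermitian operators in $\mathrm{span}(S)$ contains $\mathfrak{su}(d)$. For $a\in\mathbb B(\mathcal H)$ let $L_a(\rho)=2a\rho a^*-a^*a\rho-\rho a^*a$. $\overline{\mathrm{Channel}(S)}$ is the smallest class of maps on $\mathbb B(\mathcal H)$ such that: (UN) if $iH\in\mathrm{span}(S)$ is anti-Hermitian, then $\rho\mapsto e^{itH}\rho e^{-itH}$ belongs to the class for all $t\ge 0$; (JU) for every $a\in S$ and $t\ge 0$, $e^{tL_a}$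 belongs to the class; (CO) the class is closed under composition; (CL) the class is topologically closed. (Convexity is not imposed.) A set $\mathcal O$ of operations is transitive if for all $\rho,\sigma\in\mathcal D(\mathcal H)$ there is $\Phi\in\mathcal O$ with $\Phi(\rho)=\sigma$, or (continuous setting) there is a family $(T_t)_{t\ge0}$ in $\mathcal O$ with $T_\tau(\rho)=\sigma$ for some $\tau>0$ or $\lim_{t\to\infty}T_t(\rho)=\sigma$. *)

theory Defs
  imports "HOL-Analysis.Analysis" "HOL-Library.Nonpos_Ints"
begin

text \<open>
  Operators on the Hilbert space \<open>complex ^ 'n\<close> are identified with their matrices in the
  standard basis; \<open>A $ i $ j\<close> is the entry in row \<open>i\<close> and column \<open>j\<close>.
\<close>

type_synonym 'n operator = "complex ^ 'n ^ 'n"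

definition adj :: "'n::finite operator \<Rightarrow> 'n operator" where
  "adj A = (\<chi> i j. cnj (A $ j $ i))"

text \<open>
  The library provides only real scalar multiplication on matrices as vectors. All spans of sets
  of operators are taken with respect to the following complex scalar multiplication.
\<close>

definition cscale :: "complex \<Rightarrow> 'n::finite operator \<Rightarrow> 'n operator" (infixr "*\<^sub>c" 75) where
  "c *\<^sub>c A = (\<chi> i j. c * A $ i $ j)"

interpretation cop: vector_space "cscale :: complex \<Rightarrow> 'n::finite operator \<Rightarrow> 'n operator"
  by unfold_locales (simp_all add: cscale_def vec_eq_iff algebra_simps)

definition antihermitian :: "'n::finite operator \<Rightarrow> bool" where
  "antihermitian A \<longleftrightarrow> adj A = - A"

definition positive_op :: "'n::finite operator \<Rightarrow> bool" where
  "positive_op A \<longleftrightarrow> (\<forall>v. (\<Sum>i\<in>UNIV. cnj (v $ i) * (A *v v) $ i) \<in> \<real>\<^sub>\<ge>\<^sub>0)"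

definition states :: "'n::finite operator set" where
  "states = {\<rho>. adj \<rho> = \<rho> \<and> positive_op \<rho> \<and> trace \<rho> = 1}"

definition special_unitary_algebra :: "'n::finite operator set" where
  "special_unitary_algebra = {A. antihermitian A \<and> trace A = 0}"

text \<open>Here \<^const>\<open>subspace\<close> is the library's notion of a \<^emph>\<open>real\<close> linear subspace.\<close>

definition real_lie_algebra :: "'n::finite operator set \<Rightarrow> bool" where
  "real_lie_algebra L \<longleftrightarrow> subspace L \<and> (\<forall>A\<in>L. \<forall>B\<in>L. A ** B - B ** A \<in> L)"

definition hoermander_system :: "'n::finite operator set \<Rightarrow> bool" where
  "hoermander_system S \<longleftrightarrow>
     special_unitary_algebra \<subseteq> real_lie_algebra hull {A \<in> cop.span S. antihermitian A}"

text \<open>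
  Both exponentials are given by the power series, which converges for every matrix and, at every
  point, for every linear map on the finite-dimensional space of operators.
\<close>

definition op_exp :: "'n::finite operator \<Rightarrow> 'n operator" where
  "op_exp A = (\<Sum>n. (((**) A) ^^ n) (mat 1) /\<^sub>R fact n)"

definition superop_exp ::
    "('n::finite operator \<Rightarrow> 'n operator) \<Rightarrow> 'n operator \<Rightarrow> 'n operator" where
  "superop_exp L \<rho> = (\<Sum>n. (L ^^ n) \<rho> /\<^sub>R fact n)"

definition lindblad :: "'n::finite operator \<Rightarrow> 'n operator \<Rightarrow> 'n operator" where
  "lindblad a \<rho> = 2 *\<^sub>R (a ** \<rho> ** adj a) - adj a ** a ** \<rho> - \<rho> ** adj a ** a"

text \<open>
  The topology on \<open>'n operator \<Rightarrow> 'n operator\<close> underlying \<^const>\<open>closed\<close> is that of pointwise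
  convergence. The linear maps are closed for it, and on them it is the norm topology because
  the space of operators is finite-dimensional; hence the smallest class below consists of linear
  maps and is the same as when the closure is taken in norm.
\<close>

definition channel_class ::
    "'n::finite operator set \<Rightarrow> ('n operator \<Rightarrow> 'n operator) set \<Rightarrow> bool" where
  "channel_class S C \<longleftrightarrow>
     (\<forall>H t. \<i> *\<^sub>c H \<in> cop.span S \<and> antihermitian (\<i> *\<^sub>c H) \<and> 0 \<le> t \<longrightarrow>
        (\<lambda>\<rho>. op_exp ((\<i> * complex_of_real t) *\<^sub>c H) ** \<rho> **
             op_exp ((- \<i> * complex_of_real t) *\<^sub>c H)) \<in> C) \<and>
     (\<forall>a\<in>S. \<forall>t\<ge>0. superop_exp (\<lambda>\<rho>. t *\<^sub>R lindblad a \<rho>) \<in> C) \<and>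
     (\<forall>\<Phi>\<in>C. \<forall>\<Psi>\<in>C. \<Phi> \<circ> \<Psi> \<in> C) \<and>
     closed C"

definition closed_channels ::
    "'n::finite operator set \<Rightarrow> ('n operator \<Rightarrow> 'n operator) set" where
  "closed_channels S = \<Inter> {C. channel_class S C}"

definition transitive_operations :: "('n::finite operator \<Rightarrow> 'n operator) set \<Rightarrow> bool" where
  "transitive_operations \<O> \<longleftrightarrow>
     (\<forall>\<rho>\<in>states. \<forall>\<sigma>\<in>states.
        (\<exists>\<Phi>\<in>\<O>. \<Phi> \<rho> = \<sigma>) \<or>
        (\<exists>T :: real \<Rightarrow> 'n operator \<Rightarrow> 'n operator. (\<forall>t\<ge>0. T t \<in> \<O>) \<and>
           ((\<exists>\<tau>>0. T \<tau> \<rho> = \<sigma>) \<or> ((\<lambda>t. T t \<rho>) \<longlongrightarrow> \<sigma>) at_top)))"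

text \<open>
  A system of \<open>k\<close> qubits is rendered by a finite type \<open>'q\<close> labelling the tensor factors, with
  \<open>k = CARD('q) \<ge> 1\<close>. The standard basis of the \<open>k\<close>-fold tensor power of the space
  \<open>complex ^ 2\<close> is indexed by the functions \<open>'q \<Rightarrow> 2\<close>, so that it is
  \<open>complex ^ ('q \<Rightarrow> 2)\<close>, of dimension \<open>2 ^ k\<close>; the two elements of the numeral type \<open>2\<close>
  are \<open>0\<close> and \<open>1\<close>.
\<close>

type_synonym 'q qubits_operator = "('q \<Rightarrow> 2) operator"

definition tensor :: "('q::finite \<Rightarrow> 2 operator) \<Rightarrow> 'q qubits_operator" where
  "tensor A = (\<chi> f g. \<Prod>q\<in>UNIV. A q $ f q $ g q)"

text \<open>The operator \<open>a\<close> on the factor \<open>q\<close>, tensored with the identity on all other factors.\<close>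

definition on_factor :: "'q::finite \<Rightarrow> 2 operator \<Rightarrow> 'q qubits_operator" where
  "on_factor q a = tensor (\<lambda>p. if p = q then a else mat 1)"

definition ketbra :: "2 \<Rightarrow> 2 \<Rightarrow> 2 operator" where
  "ketbra x y = (\<chi> i j. if i = x \<and> j = y then 1 else 0)"

definition pauli_Z :: "2 operator" where
  "pauli_Z = ketbra 0 0 - ketbra 1 1"

end

(*
  The generators of the unitary conjugations in a closed semigroup of maps form a closed real Lie
  algebra: exp (A + B) is the limit of the n-th powers of exp (A / n) exp (B / n), and the commutator
  is the derivative at 0 of exp (t A) B exp (- t A). By the Hoermander condition this algebra contains
  all traceless anti-Hermitian operators, and multiples of the identity generate trivial conjugations.
  The channel to a state \<sigma> can be chosen independently of the initial state. The long-time limit of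
  the lowering jump resets the first qubit; conjugating by swaps resets every qubit, so all states
  are sent to the basis state 0...0. A Householder reflection takes it to the pure state with
  amplitudes sqrt p, where p is the spectrum of \<sigma>; the long-time limits of the Z jumps, again
  with swaps, kill all off-diagonal entries and leave diag p; a unitary rotates diag p to \<sigma>.
*)
theory Submission
  imports Defs
begin

section \<open>The matrix exponential\<close>

text \<open>Three kinds of unitaries carry the argument: swaps, reflections and one diagonalizing
  unitary. Swaps and reflections are Hermitian involutions P, for which exp (i (pi / 2) P) = i P,
  and the phase drops out of the conjugation. The diagonalizing unitary is a maximizer over the
  compact set of those unitaries whose conjugation already lies in the class, so its existence and
  its membership are obtained together.

  Since convex combinations are not at hand, mixedness must come from the jumps. The projector onto
  the vector with amplitudes sqrt p has diagonal p, and two different basis labels differ at some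
  qubit, so dephasing all qubits leaves exactly diag p. The initial state is forgotten because one
  entry survives all resets, and the preserved trace fixes it.\<close>

text \<open>
  The library's \<^const>\<open>exp\<close> is defined on Banach algebras whose unit has norm 1. The operator
  norm, unlike the norm of \<^typ>\<open>'n operator\<close> as a Euclidean space, makes the operators such an
  algebra, so they are copied to a type that carries it.
\<close>

typedef ('n::finite) matop = "UNIV :: 'n operator set"
  morphisms of_matop to_matop by simp

setup_lifting type_definition_matop

lemma matrix_mult_scaleR_left: "(r *\<^sub>R A) ** B = r *\<^sub>R (A ** B :: 'n::finite operator)"
  and matrix_mult_scaleR_right: "A ** (r *\<^sub>R B) = r *\<^sub>R (A ** B :: 'n::finite operator)"
  by (simp_all add: matrix_matrix_mult_def vec_eq_iff scaleR_sum_right)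

lemma matrix_add_rdistrib: "(A + B) ** C = A ** C + (B ** C :: 'n::finite operator)"
  by (simp add: matrix_matrix_mult_def vec_eq_iff sum.distrib distrib_right)

lemma matrix_vector_mult_scaleR_left: "(r *\<^sub>R A) *v x = r *\<^sub>R ((A :: 'n::finite operator) *v x)"
  by (simp add: matrix_vector_mult_def vec_eq_iff scaleR_sum_right)

lemma bounded_bilinear_matrix_mult:
  "bounded_bilinear ((**) :: 'n::finite operator \<Rightarrow> 'n operator \<Rightarrow> 'n operator)"
  by (auto simp: bilinear_conv_bounded_bilinear[symmetric] bilinear_def
      matrix_add_ldistrib matrix_add_rdistrib matrix_mult_scaleR_left matrix_mult_scaleR_right
      intro!: linearI)

interpretation matrix_mult: bounded_bilinear
  "(**) :: 'n::finite operator \<Rightarrow> 'n operator \<Rightarrow> 'n operator"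
  by (rule bounded_bilinear_matrix_mult)

text \<open>The entry is a coordinate of the image of a unit vector. Together with
  \<open>norm_matrix_vector_mult_le\<close> this makes both copying maps bounded, so limits pass
  between the two norms.\<close>

lemma norm_le_onorm_matrix: "norm (A $ i $ j) \<le> onorm ((*v) (A :: 'n::finite operator))"
proof -
  have "norm (A $ i $ j) = norm ((A *v axis j 1) $ i)"
    by (simp add: matrix_vector_mult_def axis_def if_distrib cong: if_cong)
  also have "\<dots> \<le> norm (A *v axis j 1)" by (rule Finite_Cartesian_Product.norm_nth_le)
  also have "\<dots> \<le> onorm ((*v) A) * norm (axis j 1 :: complex^'n)"
    by (intro onorm) simp
  finally show ?thesis by (simp add: norm_eq_1[THEN iffD2] inner_axis_axis)
qed

lemma norm_le_sum_entries: "norm (A :: 'n::finite operator) \<le> (\<Sum>i\<in>UNIV. \<Sum>j\<in>UNIV. norm (A $ i $ j))"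
proof -
  have "norm A \<le> (\<Sum>i\<in>UNIV. norm (A $ i))"
    unfolding norm_vec_def[of A] by (intro L2_set_le_sum) simp
  also have "\<dots> \<le> (\<Sum>i\<in>UNIV. \<Sum>j\<in>UNIV. norm (A $ i $ j))"
    unfolding norm_vec_def[of "A $ i" for i] by (intro sum_mono L2_set_le_sum) simp
  finally show ?thesis .
qed

lemma norm_entry_le: "norm (A $ i $ j) \<le> norm (A :: 'n::finite operator)"
  by (meson Finite_Cartesian_Product.norm_nth_le order_trans)

lemma norm_matrix_vector_mult_le:
  "norm ((A :: 'n::finite operator) *v x) \<le> real (CARD('n)) * real (CARD('n)) * norm A * norm x"
proof -
  have "norm (A *v x) \<le> (\<Sum>i\<in>UNIV. norm ((A *v x) $ i))"
    unfolding norm_vec_def[of "A *v x"] by (intro L2_set_le_sum) simp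
  also have "\<dots> \<le> (\<Sum>i\<in>(UNIV::'n set). \<Sum>j\<in>(UNIV::'n set). norm A * norm x)"
    unfolding matrix_vector_mult_def
    unfolding vec_lambda_beta
    by (intro sum_mono order_trans[OF norm_sum])
      (auto intro!: mult_mono norm_entry_le Finite_Cartesian_Product.norm_nth_le simp: norm_mult)
  finally show ?thesis by (simp add: mult.assoc)
qed

instantiation matop :: (finite) real_normed_algebra_1
begin

lift_definition norm_matop :: "'a matop \<Rightarrow> real" is "\<lambda>A. onorm ((*v) A)" .
lift_definition zero_matop :: "'a matop" is 0 .
lift_definition one_matop :: "'a matop" is "mat 1" .
lift_definition plus_matop :: "'a matop \<Rightarrow> 'a matop \<Rightarrow> 'a matop" is "(+)" .
lift_definition minus_matop :: "'a matop \<Rightarrow> 'a matop \<Rightarrow> 'a matop" is "(-)" .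
lift_definition uminus_matop :: "'a matop \<Rightarrow> 'a matop" is uminus .
lift_definition times_matop :: "'a matop \<Rightarrow> 'a matop \<Rightarrow> 'a matop" is "(**)" .
lift_definition scaleR_matop :: "real \<Rightarrow> 'a matop \<Rightarrow> 'a matop" is scaleR .

definition dist_matop :: "'a matop \<Rightarrow> 'a matop \<Rightarrow> real"
  where "dist_matop a b = norm (a - b)"

definition sgn_matop :: "'a matop \<Rightarrow> 'a matop"
  where "sgn_matop a = inverse (norm a) *\<^sub>R a"

definition [code del]: "(uniformity :: ('a matop \<times> 'a matop) filter) =
  (INF e\<in>{0 <..}. principal {(x, y). dist x y < e})"

definition open_matop :: "'a matop set \<Rightarrow> bool"
  where [code del]: "open_matop S =
    (\<forall>x\<in>S. \<forall>\<^sub>F (x', y) in uniformity. x' = x \<longrightarrow> y \<in> S)"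

instance
proof
  fix x y z :: "'a matop" and r s :: real
  show "dist x y = norm (x - y)" by (simp add: dist_matop_def)
  show "sgn x = inverse (norm x) *\<^sub>R x" by (simp add: sgn_matop_def)
  show "uniformity = (INF e\<in>{0 <..}. principal {(x, y::'a matop). dist x y < e})"
    by (simp add: uniformity_matop_def)
  show "open U = (\<forall>x\<in>U. \<forall>\<^sub>F (x', y) in uniformity. x' = x \<longrightarrow> y \<in> U)" for U :: "'a matop set"
    by (simp add: open_matop_def)
  show "x + y + z = x + (y + z)" "x + y = y + x" "0 + x = x" "- x + x = 0" "x - y = x + - y"
    by (transfer; simp)+
  show "r *\<^sub>R (x + y) = r *\<^sub>R x + r *\<^sub>R y" "(r + s) *\<^sub>R x = r *\<^sub>R x + s *\<^sub>R x"
    "r *\<^sub>R s *\<^sub>R x = (r * s) *\<^sub>R x" "1 *\<^sub>R x = x"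
    by (transfer; simp add: algebra_simps)+
  show "x * y * z = x * (y * z)" by transfer (simp add: matrix_mul_assoc)
  show "1 * x = x" "x * 1 = x" by (transfer; simp)+
  show "(x + y) * z = x * z + y * z" "x * (y + z) = x * y + x * z"
    by (transfer; simp add: matrix_add_ldistrib matrix_add_rdistrib)+
  show "r *\<^sub>R x * y = r *\<^sub>R (x * y)" "x * r *\<^sub>R y = r *\<^sub>R (x * y)"
    by (transfer; simp add: matrix_mult_scaleR_left matrix_mult_scaleR_right)+
  show "(0::'a matop) \<noteq> 1"
    by transfer (auto simp: vec_eq_iff mat_def)
  show "norm (1::'a matop) = 1"
  proof transfer
    have "(*v) (mat 1 :: 'a operator) = (\<lambda>x. x)" by (simp add: fun_eq_iff)
    then show "onorm ((*v) (mat 1 :: 'a operator)) = 1" by (simp add: onorm_id)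
  qed
  show "norm x = 0 \<longleftrightarrow> x = 0"
  proof transfer
    fix A :: "'a operator"
    show "onorm ((*v) A) = 0 \<longleftrightarrow> A = 0"
    proof
      assume "onorm ((*v) A) = 0"
      then show "A = 0" using norm_le_onorm_matrix[of A] by (simp add: vec_eq_iff)
    next
      assume "A = 0"
      then have "(*v) A = (\<lambda>x. 0)" by (simp add: fun_eq_iff)
      then show "onorm ((*v) A) = 0" by (simp add: onorm_zero)
    qed
  qed
  show "norm (x + y) \<le> norm x + norm y"
  proof transfer
    fix A B :: "'a operator"
    show "onorm ((*v) (A + B)) \<le> onorm ((*v) A) + onorm ((*v) B)"
      using onorm_triangle[of "(*v) A" "(*v) B"] by (simp flip: matrix_vector_mult_add_rdistrib)
  qed
  show "norm (r *\<^sub>R x) = \<bar>r\<bar> * norm x"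
  proof transfer
    fix A :: "'a operator" and r :: real
    show "onorm ((*v) (r *\<^sub>R A)) = \<bar>r\<bar> * onorm ((*v) A)"
      using onorm_scaleR[of "(*v) A" r] by (simp flip: matrix_vector_mult_scaleR_left)
  qed
  show "norm (x * y) \<le> norm x * norm y"
  proof transfer
    fix A B :: "'a operator"
    show "onorm ((*v) (A ** B)) \<le> onorm ((*v) A) * onorm ((*v) B)"
      using onorm_compose[of "(*v) A" "(*v) B"]
      by (simp add: o_def matrix_vector_mul_assoc)
  qed
qed

end

lemma bounded_linear_of_matop: "bounded_linear (of_matop :: 'n::finite matop \<Rightarrow> 'n operator)"
proof (rule bounded_linear_intro)
  fix x y :: "'n matop" and r :: real
  show "of_matop (x + y) = of_matop x + of_matop y" "of_matop (r *\<^sub>R x) = r *\<^sub>R of_matop x"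
    by (simp_all add: plus_matop.rep_eq scaleR_matop.rep_eq)
  have "norm (of_matop x) \<le> (\<Sum>i\<in>(UNIV::'n set). \<Sum>j\<in>(UNIV::'n set). norm x)"
    unfolding norm_matop.rep_eq
    by (intro order_trans[OF norm_le_sum_entries] sum_mono norm_le_onorm_matrix)
  then show "norm (of_matop x) \<le> norm x * (real (CARD('n)) * real (CARD('n)))"
    by (simp add: ac_simps)
qed

lemma bounded_linear_to_matop: "bounded_linear (to_matop :: 'n::finite operator \<Rightarrow> 'n matop)"
proof (rule bounded_linear_intro)
  fix A B :: "'n operator" and r :: real
  show "to_matop (A + B) = to_matop A + to_matop B" "to_matop (r *\<^sub>R A) = r *\<^sub>R to_matop A"
    by (simp_all add: plus_matop.abs_eq scaleR_matop.abs_eq)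
  show "norm (to_matop A) \<le> norm A * (real (CARD('n)) * real (CARD('n)))"
    unfolding norm_matop.abs_eq
    by (rule onorm_le) (use norm_matrix_vector_mult_le[of A] in \<open>simp add: ac_simps\<close>)
qed

lemma to_matop_mult: "to_matop (A ** B) = to_matop A * to_matop B"
  and of_matop_mult: "of_matop (x * y) = of_matop x ** of_matop y"
  by (simp_all add: times_matop.abs_eq times_matop.rep_eq)

instance matop :: (finite) banach
proof
  fix X :: "nat \<Rightarrow> 'a matop"
  assume "Cauchy X"
  then have "convergent (\<lambda>n. of_matop (X n))"
    using bounded_linear.Cauchy[OF bounded_linear_of_matop] Cauchy_convergent by blast
  then obtain L where "(\<lambda>n. of_matop (X n)) \<longlonglongrightarrow> L" by (auto simp: convergent_def)
  from bounded_linear.tendsto[OF bounded_linear_to_matop this]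
  show "convergent X" by (auto simp: of_matop_inverse convergent_def)
qed

section \<open>The exponential series and its algebraic rules\<close>

lemma of_matop_power: "of_matop (to_matop A ^ n) = (((**) A) ^^ n) (mat 1)"
  by (induction n) (simp_all add: one_matop.rep_eq of_matop_mult to_matop_inverse)

text \<open>Convergence gives the bare infinite sum in \<open>op_exp_def\<close> its meaning. The
  series is the image of the Banach algebra exponential under a bounded linear map.\<close>

lemma op_exp_sums: "(\<lambda>n. (((**) A) ^^ n) (mat 1) /\<^sub>R fact n) sums of_matop (exp (to_matop A))"
proof -
  have eq: "of_matop (to_matop A ^ n /\<^sub>R fact n) = (((**) A) ^^ n) (mat 1) /\<^sub>R fact n" for n
    by (simp add: scaleR_matop.rep_eq of_matop_power)
  show ?thesis
    using bounded_linear.sums[OF bounded_linear_of_matop exp_converges[of "to_matop A"]]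
    unfolding eq .
qed

lemma op_exp_eq: "op_exp A = of_matop (exp (to_matop A))"
  unfolding op_exp_def using op_exp_sums by (rule sums_unique[symmetric])

lemma op_exp_zero [simp]: "op_exp 0 = mat 1"
  by (simp add: op_exp_eq one_matop.rep_eq flip: zero_matop.abs_eq)

lemma op_exp_add_commuting:
  assumes "A ** B = B ** A"
  shows "op_exp (A + B) = op_exp A ** op_exp B"
proof -
  have "to_matop A * to_matop B = to_matop B * to_matop A"
    using assms by (simp flip: to_matop_mult)
  then show ?thesis
    by (simp add: op_exp_eq of_matop_mult exp_add_commuting flip: plus_matop.abs_eq)
qed

lemma op_exp_scaleR_add:
  "op_exp ((s + t) *\<^sub>R A) = op_exp (s *\<^sub>R A) ** op_exp (t *\<^sub>R A)"
  by (simp add: scaleR_add_left op_exp_add_commuting matrix_mult_scaleR_left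
      matrix_mult_scaleR_right ac_simps)

lemma op_exp_minus_right: "op_exp A ** op_exp (- A) = mat 1"
  using op_exp_scaleR_add[of 1 "-1" A] by simp

lemma op_exp_minus_left: "op_exp (- A) ** op_exp A = mat 1"
  using op_exp_scaleR_add[of "-1" 1 A] by simp

text \<open>On the ball of radius \<open>norm a + 1\<close>, which has \<open>a\<close> in its
  interior, the series is dominated by the real exponential series, so its continuous partial sums
  converge uniformly.\<close>

lemma tendsto_exp_banach_algebra:
  fixes a :: "'a::{real_normed_algebra_1,banach}"
  assumes "(f \<longlongrightarrow> a) F"
  shows "((\<lambda>x. exp (f x)) \<longlongrightarrow> exp a) F"
proof -
  define R where "R = norm a + 1"
  have "uniform_limit (ball (0::'a) R) (\<lambda>n x. \<Sum>i<n. x ^ i /\<^sub>R fact i) (\<lambda>x. \<Sum>i. x ^ i /\<^sub>R fact i) sequentially"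
  proof (rule Weierstrass_m_test)
    show "summable (\<lambda>n. inverse (fact n) * R ^ n)" by (rule summable_exp)
    show "norm (x ^ n /\<^sub>R fact n) \<le> inverse (fact n) * R ^ n" if "x \<in> ball 0 R" for x :: 'a and n
      using that by (auto intro!: mult_left_mono order_trans[OF norm_power_ineq] power_mono)
  qed
  then have "continuous_on (ball 0 R) (exp :: 'a \<Rightarrow> 'a)"
    unfolding exp_def by (rule uniform_limit_theorem[rotated]) (auto intro!: always_eventually continuous_intros)
  then have "isCont exp a"
    by (rule continuous_on_interior) (simp add: R_def)
  then show ?thesis
    using assms by (rule isCont_tendsto_compose)
qed

lemma tendsto_op_exp:
  assumes "(f \<longlongrightarrow> A) F"
  shows "((\<lambda>x. op_exp (f x)) \<longlongrightarrow> op_exp A) F"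
  unfolding op_exp_eq
  by (intro bounded_linear.tendsto[OF bounded_linear_of_matop] tendsto_exp_banach_algebra
      bounded_linear.tendsto[OF bounded_linear_to_matop] assms)

lemma op_exp_has_vector_derivative_zero:
  "((\<lambda>t. op_exp (t *\<^sub>R A)) has_vector_derivative A) (at 0)"
proof -
  have "((\<lambda>t. exp (t *\<^sub>R to_matop A)) has_vector_derivative exp (0 *\<^sub>R to_matop A) * to_matop A) (at 0)"
    by (rule exp_scaleR_has_vector_derivative_right)
  from bounded_linear.has_vector_derivative[OF bounded_linear_of_matop this]
  show ?thesis
    by (simp add: op_exp_eq scaleR_matop.abs_eq to_matop_inverse flip: zero_matop.abs_eq)
qed

text \<open>The inner factors \<open>W ** V\<close> cancel in every power, and multiplication from
  either side passes through the series.\<close>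

lemma op_exp_similarity:
  fixes A V W :: "'n::finite operator"
  assumes "W ** V = mat 1"
  shows "op_exp (V ** A ** W) = V ** op_exp A ** W"
proof -
  have VW: "V ** W = mat 1" by (rule matrix_left_right_inverse[THEN iffD1, OF assms])
  have pow: "(((**) (V ** A ** W)) ^^ n) (mat 1) = V ** (((**) A) ^^ n) (mat 1) ** W" for n
  proof (induction n)
    case (Suc n)
    have "V ** A ** W ** (V ** X ** W) = V ** (A ** ((W ** V) ** X)) ** W" for X
      by (simp only: matrix_mul_assoc)
    then show ?case using Suc by (simp add: assms)
  qed (simp add: VW)
  have "(\<lambda>n. V ** ((((**) A) ^^ n) (mat 1) /\<^sub>R fact n) ** W) sums (V ** op_exp A ** W)"
    unfolding op_exp_eq
    by (intro matrix_mult.bounded_linear_left[THEN bounded_linear.sums]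
        matrix_mult.bounded_linear_right[THEN bounded_linear.sums] op_exp_sums)
  then show ?thesis
    unfolding op_exp_def pow matrix_mult_scaleR_left matrix_mult_scaleR_right by (rule sums_unique[symmetric])
qed

section \<open>Adjoints, commutation and Euler's formula\<close>

lemma adj_mult: "adj (A ** B) = adj B ** adj A"
  by (simp add: adj_def matrix_matrix_mult_def vec_eq_iff mult.commute)

lemma adj_adj [simp]: "adj (adj A) = A"
  by (simp add: adj_def vec_eq_iff)

lemma adj_one [simp]: "adj (mat 1) = mat 1"
  by (auto simp: adj_def mat_def vec_eq_iff)

lemma bounded_linear_adj: "bounded_linear (adj :: 'n::finite operator \<Rightarrow> 'n operator)"
  by (simp add: linear_conv_bounded_linear[symmetric] linear_iff adj_def vec_eq_iff)

lemma adj_add: "adj (A + B) = adj A + adj B"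
  and adj_diff: "adj (A - B) = adj A - adj B"
  and adj_scaleR: "adj (r *\<^sub>R A) = r *\<^sub>R adj A"
  by (simp_all add: adj_def vec_eq_iff)

lemma adj_op_exp: "adj (op_exp A) = op_exp (adj A)"
proof -
  \<comment> \<open>The adjoint reverses products, so the inductive step of \<open>pow\<close> puts
    the new factor on the right; this moves it back to the left.\<close>
  have commute: "(((**) B) ^^ n) (mat 1) ** B = B ** (((**) B) ^^ n) (mat 1)" for n and B :: "'a operator"
    by (induction n) (simp_all flip: matrix_mul_assoc)
  have pow: "adj ((((**) A) ^^ n) (mat 1)) = (((**) (adj A)) ^^ n) (mat 1)" for n
    by (induction n) (simp_all add: adj_mult commute)
  have "(\<lambda>n. adj ((((**) A) ^^ n) (mat 1) /\<^sub>R fact n)) sums adj (op_exp A)"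
    unfolding op_exp_eq by (rule bounded_linear.sums[OF bounded_linear_adj op_exp_sums])
  then show ?thesis
    unfolding op_exp_def[of "adj A"] adj_scaleR pow by (rule sums_unique)
qed

lemma op_exp_commute:
  assumes "A ** B = B ** A"
  shows "op_exp A ** B = B ** op_exp A"
proof -
  have pow: "(((**) A) ^^ n) (mat 1) ** B = B ** (((**) A) ^^ n) (mat 1)" for n
  proof (induction n)
    case (Suc n)
    then show ?case by simp (metis assms matrix_mul_assoc)
  qed simp
  have "(\<lambda>n. ((((**) A) ^^ n) (mat 1) /\<^sub>R fact n) ** B) sums (op_exp A ** B)"
    unfolding op_exp_eq by (intro matrix_mult.bounded_linear_left[THEN bounded_linear.sums] op_exp_sums)
  moreover have "(\<lambda>n. B ** ((((**) A) ^^ n) (mat 1) /\<^sub>R fact n)) sums (B ** op_exp A)"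
    unfolding op_exp_eq by (intro matrix_mult.bounded_linear_right[THEN bounded_linear.sums] op_exp_sums)
  ultimately show ?thesis
    unfolding matrix_mult_scaleR_left matrix_mult_scaleR_right pow by (rule sums_unique2)
qed

text \<open>Euler's formula with \<open>A\<close> as the imaginary unit; the recursions of
  \<open>cos_coeff\<close> and \<open>sin_coeff\<close> follow multiplication by
  \<open>A\<close>.\<close>

lemma op_exp_complex_structure:
  assumes "A ** A = - mat 1"
  shows "op_exp (t *\<^sub>R A) = cos t *\<^sub>R mat 1 + sin t *\<^sub>R A"
proof -
  have pow: "(((**) (t *\<^sub>R A)) ^^ n) (mat 1) /\<^sub>R fact n =
      (cos_coeff n *\<^sub>R t ^ n) *\<^sub>R mat 1 + (sin_coeff n *\<^sub>R t ^ n) *\<^sub>R A" for n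
  proof (induction n)
    case (Suc n)
    have "(((**) (t *\<^sub>R A)) ^^ Suc n) (mat 1) /\<^sub>R fact (Suc n) =
        (t / real (Suc n)) *\<^sub>R (A ** ((((**) (t *\<^sub>R A)) ^^ n) (mat 1) /\<^sub>R fact n))"
      by (simp add: matrix_mult_scaleR_left matrix_mult_scaleR_right field_simps)
    also have "\<dots> = (cos_coeff (Suc n) *\<^sub>R t ^ Suc n) *\<^sub>R mat 1 + (sin_coeff (Suc n) *\<^sub>R t ^ Suc n) *\<^sub>R A"
      unfolding Suc
      by (simp add: matrix_add_ldistrib matrix_mult_scaleR_right assms cos_coeff_Suc sin_coeff_Suc
          scaleR_diff_right mult.left_commute)
    finally show ?case .
  qed simp
  have "(\<lambda>n. (cos_coeff n *\<^sub>R t ^ n) *\<^sub>R mat 1 + (sin_coeff n *\<^sub>R t ^ n) *\<^sub>R A) sums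
      (cos t *\<^sub>R mat 1 + sin t *\<^sub>R A)"
    by (intro sums_add bounded_linear.sums[OF bounded_linear_scaleR_left] cos_converges sin_converges)
  then show ?thesis
    unfolding op_exp_def pow by (rule sums_unique[symmetric])
qed

section \<open>Exponentials as limits of powers\<close>

lemma norm_power_diff_le:
  fixes x y :: "'a::real_normed_algebra_1"
  assumes "norm x \<le> c" "norm y \<le> c" "1 \<le> c"
  shows "norm (x ^ m - y ^ m) \<le> real m * c ^ m * norm (x - y)"
proof (induction m)
  case (Suc m)
  have "x ^ Suc m - y ^ Suc m = x * (x ^ m - y ^ m) + (x - y) * y ^ m"
    by (simp add: algebra_simps)
  then have "norm (x ^ Suc m - y ^ Suc m) \<le> norm x * norm (x ^ m - y ^ m) + norm (x - y) * norm (y ^ m)"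
    by (metis norm_triangle_le add_mono norm_mult_ineq)
  also have "\<dots> \<le> c * (real m * c ^ m * norm (x - y)) + norm (x - y) * c ^ m"
    using assms Suc
    by (intro add_mono mult_mono order_trans[OF norm_power_ineq] power_mono) auto
  \<comment> \<open>The sharp exponent would be one smaller; the extra factor \<open>c\<close> keeps
    the bound uniform in shape and costs nothing because \<open>1 \<le> c\<close>.\<close>
  also have "\<dots> \<le> c * (real m * c ^ m * norm (x - y)) + norm (x - y) * c ^ Suc m"
    using assms by (intro add_left_mono mult_left_mono power_increasing) auto
  finally show ?case by (simp add: algebra_simps)
qed simp

text \<open>The product formula needs \<open>n\<close>-th powers and closedness is used through
  sequences, so the derivative is taken along the steps \<open>1 / Suc n\<close>.\<close>

lemma difference_quotient_tendsto:
  assumes "(f has_vector_derivative d) (at 0)"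
  shows "(\<lambda>n. real (Suc n) *\<^sub>R (f (1 / real (Suc n)) - f 0)) \<longlonglongrightarrow> d"
proof -
  have lim: "((\<lambda>h. norm (f (0 + h) - f 0 - h *\<^sub>R d) / norm h) \<longlongrightarrow> 0) (at 0)"
    using assms unfolding has_vector_derivative_def has_derivative_at by blast
  have "filterlim (\<lambda>n. 1 / real (Suc n)) (at 0) sequentially"
    unfolding filterlim_at using LIMSEQ_inverse_real_of_nat
    by (auto simp: inverse_eq_divide)
  from filterlim_compose[OF lim this]
  have "(\<lambda>n. norm (f (1 / real (Suc n)) - f 0 - (1 / real (Suc n)) *\<^sub>R d) * real (Suc n)) \<longlonglongrightarrow> 0"
    by (simp del: of_nat_Suc)
  moreover have "norm (f (1 / real (Suc n)) - f 0 - (1 / real (Suc n)) *\<^sub>R d) * real (Suc n) =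
      norm (real (Suc n) *\<^sub>R (f (1 / real (Suc n)) - f 0) - d)" for n
  proof -
    have "real (Suc n) *\<^sub>R (f (1 / real (Suc n)) - f 0) - d =
        real (Suc n) *\<^sub>R (f (1 / real (Suc n)) - f 0 - (1 / real (Suc n)) *\<^sub>R d)"
      by (simp add: scaleR_diff_right del: of_nat_Suc)
    then show ?thesis by (simp del: of_nat_Suc)
  qed
  ultimately have "(\<lambda>n. norm (real (Suc n) *\<^sub>R (f (1 / real (Suc n)) - f 0) - d)) \<longlonglongrightarrow> 0"
    by simp
  then show ?thesis
    by (simp add: tendsto_norm_zero_iff LIM_zero_iff del: of_nat_Suc)
qed

text \<open>Both \<open>x n\<close> and \<open>exp (a / n)\<close> are \<open>1 + a / n + o(1 / n)\<close>.\<close>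

lemma power_tendsto_exp:
  fixes a :: "'a::{real_normed_algebra_1,banach}"
  assumes lim: "(\<lambda>n. real (Suc n) *\<^sub>R (x n - 1)) \<longlonglongrightarrow> a"
  shows "(\<lambda>n. x n ^ Suc n) \<longlonglongrightarrow> exp a"
proof -
  define y where "y n = exp ((1 / real (Suc n)) *\<^sub>R a)" for n
  have exp_power: "exp b ^ m = exp (real m *\<^sub>R b)" for m and b :: 'a
  proof (induction m)
    case (Suc m)
    then show ?case
      using exp_add_commuting[of b "real m *\<^sub>R b"] by (simp add: scaleR_add_left)
  qed simp
  have y_power: "y n ^ Suc n = exp a" for n
    unfolding y_def exp_power by (simp del: of_nat_Suc)
  have "((\<lambda>t. exp (t *\<^sub>R a)) has_vector_derivative exp (0 *\<^sub>R a) * a) (at 0)"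
    by (rule exp_scaleR_has_vector_derivative_right)
  from difference_quotient_tendsto[OF this]
  have limy: "(\<lambda>n. real (Suc n) *\<^sub>R (y n - 1)) \<longlonglongrightarrow> a"
    by (simp add: y_def del: of_nat_Suc)
  obtain K where K: "\<And>n. norm (real (Suc n) *\<^sub>R (x n - 1)) \<le> K"
    using convergent_imp_Bseq[OF convergentI[OF lim]] by (auto simp: Bseq_def)
  \<comment> \<open>A common bound for both factors: norms at most \<open>exp (M / Suc n)\<close>
    have powers of order \<open>Suc n\<close> that stay below \<open>exp M\<close>.\<close>
  define M where "M = max K (norm a)"
  have x_le: "norm (x n) \<le> exp (M / real (Suc n))" for n
  proof -
    have "norm (x n - 1) * real (Suc n) \<le> M"
      using K[of n] by (simp add: M_def mult.commute del: of_nat_Suc)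
    then have "norm (x n - 1) \<le> M / real (Suc n)" by (simp add: pos_le_divide_eq del: of_nat_Suc)
    then have "norm (x n) \<le> 1 + M / real (Suc n)"
      using norm_triangle_ineq[of "x n - 1" 1] by simp
    then show ?thesis by (rule order_trans[OF _ exp_ge_add_one_self])
  qed
  have y_le: "norm (y n) \<le> exp (M / real (Suc n))" for n
    unfolding y_def by (rule order_trans[OF norm_exp]) (simp add: M_def divide_right_mono del: of_nat_Suc)
  have M: "0 \<le> M" unfolding M_def by (rule max.coboundedI2) simp
  \<comment> \<open>The factor \<open>Suc n\<close> from the telescoping estimate is absorbed by the
    two difference quotients, which share the limit \<open>a\<close>.\<close>
  have bound: "norm (x n ^ Suc n - exp a) \<le>
      exp M * norm (real (Suc n) *\<^sub>R (x n - 1) - real (Suc n) *\<^sub>R (y n - 1))" for n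
  proof -
    have "norm (x n ^ Suc n - y n ^ Suc n) \<le> real (Suc n) * exp (M / real (Suc n)) ^ Suc n * norm (x n - y n)"
      by (rule norm_power_diff_le[OF x_le y_le]) (use M in simp)
    also have "exp (M / real (Suc n)) ^ Suc n = exp M"
      by (rule exp_divide_power_eq) simp
    also have "norm (x n - y n) = norm ((x n - 1) - (y n - 1))" by simp
    also have "real (Suc n) * exp M * \<dots> =
        exp M * norm (real (Suc n) *\<^sub>R (x n - 1) - real (Suc n) *\<^sub>R (y n - 1))"
      unfolding scaleR_diff_right[symmetric] norm_scaleR by (simp del: of_nat_Suc)
    finally show ?thesis by (simp only: y_power)
  qed
  have "(\<lambda>n. exp M * norm (real (Suc n) *\<^sub>R (x n - 1) - real (Suc n) *\<^sub>R (y n - 1))) \<longlonglongrightarrow>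
      exp M * norm (a - a)"
    by (intro tendsto_intros lim limy)
  then have "(\<lambda>n. x n ^ Suc n - exp a) \<longlonglongrightarrow> 0"
    by (intro Lim_null_comparison[OF always_eventually[OF allI[OF bound]]]) (simp del: of_nat_Suc)
  then show ?thesis by (simp add: LIM_zero_iff)
qed

text \<open>Chernoff's form of the product formula: only the velocity of the curve at the identity
  matters. For a product of two one-parameter groups it is the Lie-Trotter formula.\<close>

lemma op_power_tendsto_op_exp:
  assumes "(f has_vector_derivative A) (at 0)" "f 0 = mat 1"
  shows "(\<lambda>n. (((**) (f (1 / real (Suc n)))) ^^ Suc n) (mat 1)) \<longlonglongrightarrow> op_exp A"
proof -
  have "(\<lambda>n. to_matop (real (Suc n) *\<^sub>R (f (1 / real (Suc n)) - mat 1))) \<longlonglongrightarrow> to_matop A"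
    using difference_quotient_tendsto[OF assms(1)] unfolding assms(2)
    by (rule bounded_linear.tendsto[OF bounded_linear_to_matop])
  then have "(\<lambda>n. real (Suc n) *\<^sub>R (to_matop (f (1 / real (Suc n))) - 1)) \<longlonglongrightarrow> to_matop A"
    by (simp add: scaleR_matop.abs_eq[symmetric] minus_matop.abs_eq[symmetric] one_matop.abs_eq[symmetric]
        del: of_nat_Suc)
  from bounded_linear.tendsto[OF bounded_linear_of_matop power_tendsto_exp[OF this]]
  show ?thesis by (simp only: op_exp_eq of_matop_power)
qed

section \<open>Unitary conjugations in a closed semigroup of maps\<close>

text \<open>With \<open>adj V\<close> in place of an inverse, the map is multiplicative and
  continuous in \<open>V\<close> for all matrices, with no unitarity side condition.\<close>

definition conj_map :: "'n::finite operator \<Rightarrow> 'n operator \<Rightarrow> 'n operator" where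
  "conj_map V \<rho> = V ** \<rho> ** adj V"

lemma conj_map_compose: "conj_map V \<circ> conj_map W = conj_map (V ** W)"
  by (rule ext) (simp add: conj_map_def adj_mult matrix_mul_assoc)

lemma conj_map_one: "conj_map (mat 1) = id"
  by (rule ext) (simp add: conj_map_def)

lemma tendsto_fun:
  assumes "\<And>x. ((\<lambda>n. f n x) \<longlongrightarrow> g x) F"
  shows "(f \<longlongrightarrow> g) F"
proof -
  have "limitin (product_topology (\<lambda>_. euclidean) UNIV) f g F"
    unfolding limitin_componentwise using assms by (simp add: always_eventually)
  then show ?thesis
    unfolding euclidean_product_topology limitin_canonical_iff .
qed

lemma tendsto_conj_map:
  assumes "(V \<longlongrightarrow> W) F"
  shows "((\<lambda>n. conj_map (V n)) \<longlongrightarrow> conj_map W) F"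
  unfolding conj_map_def
  by (intro tendsto_fun matrix_mult.tendsto bounded_linear.tendsto[OF bounded_linear_adj] assms tendsto_const)

lemma antihermitian_simps:
  "antihermitian (0 :: 'n::finite operator)"
  "antihermitian A \<Longrightarrow> antihermitian (r *\<^sub>R A)"
  "antihermitian A \<Longrightarrow> antihermitian B \<Longrightarrow> antihermitian (A + B)"
  "antihermitian A \<Longrightarrow> antihermitian B \<Longrightarrow> antihermitian (A - B)"
  "antihermitian A \<Longrightarrow> antihermitian B \<Longrightarrow> antihermitian (A ** B - B ** A)"
  by (simp_all add: antihermitian_def adj_scaleR adj_add adj_diff adj_mult
      matrix_mult.minus_left matrix_mult.minus_right linear_0[OF bounded_linear.linear[OF bounded_linear_adj]])

lemma adj_op_exp_antihermitian: "antihermitian A \<Longrightarrow> adj (op_exp A) = op_exp (- A)"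
  by (simp add: adj_op_exp antihermitian_def)

section \<open>The Lie algebra of generators\<close>

locale closed_semigroup =
  fixes C :: "('n::finite operator \<Rightarrow> 'n operator) set"
  assumes id_mem: "id \<in> C"
    and comp_mem: "\<Phi> \<in> C \<Longrightarrow> \<Psi> \<in> C \<Longrightarrow> \<Phi> \<circ> \<Psi> \<in> C"
    and closed_C: "closed C"
begin

lemma limit_mem:
  assumes "\<And>n. \<Phi> n \<in> C" "\<And>\<rho>. (\<lambda>n. \<Phi> n \<rho>) \<longlonglongrightarrow> \<Psi> \<rho>"
  shows "\<Psi> \<in> C"
  by (rule closed_sequentially[OF closed_C assms(1) tendsto_fun[OF assms(2)]])

lemma conj_map_limit_mem:
  assumes "\<And>n. conj_map (V n) \<in> C" "V \<longlonglongrightarrow> W"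
  shows "conj_map W \<in> C"
  by (rule closed_sequentially[OF closed_C assms(1) tendsto_conj_map[OF assms(2)]])

lemma conj_map_power_mem:
  assumes "conj_map V \<in> C"
  shows "conj_map ((((**) V) ^^ n) (mat 1)) \<in> C"
proof (induction n)
  case 0
  show ?case unfolding funpow_0 conj_map_one by (rule id_mem)
next
  case (Suc n)
  have "(((**) V) ^^ Suc n) (mat 1) = V ** (((**) V) ^^ n) (mat 1)" by simp
  then show ?case
    using comp_mem[OF assms Suc] by (simp only: conj_map_compose)
qed

text \<open>All real times are demanded, so that negatives of generators are generators; nonnegative
  times alone would a priori give only a cone.\<close>

definition generators :: "'n operator set" where
  "generators = {A. antihermitian A \<and> (\<forall>t. conj_map (op_exp (t *\<^sub>R A)) \<in> C)}"

lemma conj_map_op_exp_mem: "A \<in> generators \<Longrightarrow> conj_map (op_exp A) \<in> C"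
  unfolding generators_def by (drule CollectD, drule conjunct2, drule spec[of _ 1]) simp

lemma generators_scaleR: "A \<in> generators \<Longrightarrow> r *\<^sub>R A \<in> generators"
  by (simp add: generators_def antihermitian_simps)

lemma generators_add:
  assumes "A \<in> generators" "B \<in> generators"
  shows "A + B \<in> generators"
proof -
  have "conj_map (op_exp (t *\<^sub>R (A + B))) \<in> C" for t
  proof -
    define f where "f s = op_exp (s *\<^sub>R t *\<^sub>R A) ** op_exp (s *\<^sub>R t *\<^sub>R B)" for s
    have "(f has_vector_derivative
        (op_exp (0 *\<^sub>R t *\<^sub>R A) ** (t *\<^sub>R B) + t *\<^sub>R A ** op_exp (0 *\<^sub>R t *\<^sub>R B))) (at 0)"
      unfolding f_def by (intro matrix_mult.has_vector_derivative op_exp_has_vector_derivative_zero)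
    then have "(f has_vector_derivative (t *\<^sub>R (A + B))) (at 0)"
      by (simp add: scaleR_add_right add.commute)
    moreover have "f 0 = mat 1" by (simp add: f_def)
    ultimately have lim: "(\<lambda>n. (((**) (f (1 / real (Suc n)))) ^^ Suc n) (mat 1)) \<longlonglongrightarrow> op_exp (t *\<^sub>R (A + B))"
      by (rule op_power_tendsto_op_exp)
    have "conj_map (f s) \<in> C" for s
      unfolding f_def conj_map_compose[symmetric]
      using assms by (intro comp_mem conj_map_op_exp_mem generators_scaleR)
    show ?thesis
      by (rule conj_map_limit_mem[OF conj_map_power_mem lim]) fact
  qed
  then show ?thesis using assms by (simp add: generators_def antihermitian_simps)
qed

text \<open>Serves the commutator, which is reached only as a limit of difference quotients inside
  the set.\<close>

lemma generators_closed:
  assumes "\<And>n. A n \<in> generators" "A \<longlonglongrightarrow> B"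
  shows "B \<in> generators"
proof -
  have "adj B = - B"
  proof (rule LIMSEQ_unique)
    show "(\<lambda>n. adj (A n)) \<longlonglongrightarrow> adj B"
      by (intro bounded_linear.tendsto[OF bounded_linear_adj] assms)
    show "(\<lambda>n. adj (A n)) \<longlonglongrightarrow> - B"
      using assms(1) tendsto_minus[OF assms(2)] by (simp add: generators_def antihermitian_def)
  qed
  moreover have "conj_map (op_exp (t *\<^sub>R B)) \<in> C" for t
    by (rule conj_map_limit_mem[of "\<lambda>n. op_exp (t *\<^sub>R A n)"])
      (use assms in \<open>auto simp: generators_def intro!: tendsto_op_exp tendsto_intros\<close>)
  ultimately show ?thesis by (simp add: generators_def antihermitian_def)
qed

text \<open>The exponential of a conjugate is the conjugate of the exponential, so the conjugation
  is a composition of three members, the outer two coming from \<open>A\<close> and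
  \<open>- A\<close>.\<close>

lemma generators_conjugate:
  assumes "A \<in> generators" "B \<in> generators"
  shows "op_exp A ** B ** op_exp (- A) \<in> generators"
proof -
  have anti: "antihermitian A" "antihermitian B" using assms by (simp_all add: generators_def)
  have "adj (op_exp (- A)) = op_exp A"
    using adj_op_exp_antihermitian[of "- A"] antihermitian_simps(2)[OF anti(1), of "-1"] by simp
  then have "antihermitian (op_exp A ** B ** op_exp (- A))"
    using anti by (simp add: antihermitian_def[of "op_exp A ** B ** op_exp (- A)"] adj_mult
        adj_op_exp_antihermitian matrix_mul_assoc antihermitian_def[of B] matrix_mult.minus_right
        matrix_mult.minus_left)
  moreover have "conj_map (op_exp (t *\<^sub>R (op_exp A ** B ** op_exp (- A)))) \<in> C" for t
  proof -
    have "op_exp (t *\<^sub>R (op_exp A ** B ** op_exp (- A))) = op_exp (op_exp A ** (t *\<^sub>R B) ** op_exp (- A))"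
      by (simp add: matrix_mult_scaleR_left matrix_mult_scaleR_right)
    also have "\<dots> = op_exp A ** op_exp (t *\<^sub>R B) ** op_exp (- A)"
      by (rule op_exp_similarity[OF op_exp_minus_left])
    finally have eq: "op_exp (t *\<^sub>R (op_exp A ** B ** op_exp (- A))) =
        op_exp A ** op_exp (t *\<^sub>R B) ** op_exp (- A)" .
    show ?thesis
      unfolding eq conj_map_compose[symmetric]
      using assms generators_scaleR[OF assms(1), of "-1"]
      by (intro comp_mem conj_map_op_exp_mem generators_scaleR) simp_all
  qed
  ultimately show ?thesis by (simp add: generators_def)
qed

lemma generators_commutator:
  assumes "A \<in> generators" "B \<in> generators"
  shows "A ** B - B ** A \<in> generators"
proof -
  define f where "f s = op_exp (s *\<^sub>R A) ** B ** op_exp (s *\<^sub>R (- A))" for s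
  \<comment> \<open>The unsimplified shape of the product rule; the zero is the derivative of the
    constant factor \<open>B\<close>.\<close>
  have "(f has_vector_derivative
      (op_exp (0 *\<^sub>R A) ** B ** (- A) + (op_exp (0 *\<^sub>R A) ** 0 + A ** B) ** op_exp (0 *\<^sub>R (- A)))) (at 0)"
    unfolding f_def
    by (intro matrix_mult.has_vector_derivative op_exp_has_vector_derivative_zero has_vector_derivative_const)
  then have "(f has_vector_derivative (A ** B - B ** A)) (at 0)"
    by (simp add: matrix_mult.minus_right)
  from difference_quotient_tendsto[OF this] show ?thesis
  proof (rule generators_closed[rotated])
    fix n
    have "f s \<in> generators" for s
      unfolding f_def using generators_conjugate[OF generators_scaleR[OF assms(1)] assms(2), of s] by simp
    moreover have "f 0 = B" by (simp add: f_def)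
    ultimately show "real (Suc n) *\<^sub>R (f (1 / real (Suc n)) - f 0) \<in> generators"
      using generators_add[OF _ generators_scaleR[OF assms(2), of "-1"]]
      by (auto intro!: generators_scaleR)
  qed
qed

lemma real_lie_algebra_generators: "real_lie_algebra generators"
proof -
  have "0 \<in> generators"
    using id_mem by (simp only: generators_def antihermitian_simps conj_map_one scaleR_zero_right
        op_exp_zero mem_Collect_eq simp_thms)
  then show ?thesis
    by (auto simp: real_lie_algebra_def subspace_def generators_add generators_scaleR generators_commutator)
qed

text \<open>A scalar is central, so its exponential moves past \<open>\<rho>\<close> and cancels
  against its adjoint: at every time the conjugation is \<open>id\<close>.\<close>

lemma scalar_mem_generators: "(\<i> * complex_of_real r) *\<^sub>c mat 1 \<in> generators"
proof -
  define A where "A = (\<i> * complex_of_real r) *\<^sub>c (mat 1 :: 'n operator)"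
  have anti: "antihermitian A"
    by (auto simp: A_def antihermitian_def adj_def cscale_def mat_def vec_eq_iff)
  have A_mult: "A ** B = (\<i> * complex_of_real r) *\<^sub>c B" "B ** A = (\<i> * complex_of_real r) *\<^sub>c B" for B
    by (auto simp: A_def cscale_def mat_def vec_eq_iff matrix_matrix_mult_def if_distrib if_distribR
        mult.assoc cong: if_cong)
  have "conj_map (op_exp (t *\<^sub>R A)) = id" for t
  proof -
    have "conj_map (op_exp (t *\<^sub>R A)) \<rho> = \<rho>" for \<rho>
    proof -
      have "op_exp (t *\<^sub>R A) ** \<rho> = \<rho> ** op_exp (t *\<^sub>R A)"
        by (rule op_exp_commute) (simp add: matrix_mult_scaleR_left matrix_mult_scaleR_right A_mult)
      then have "conj_map (op_exp (t *\<^sub>R A)) \<rho> = \<rho> ** (op_exp (t *\<^sub>R A) ** op_exp (- (t *\<^sub>R A)))"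
        by (simp add: conj_map_def adj_op_exp_antihermitian antihermitian_simps anti matrix_mul_assoc)
      then show ?thesis by (simp add: op_exp_minus_right)
    qed
    then show ?thesis by (simp add: fun_eq_iff)
  qed
  then show ?thesis using anti by (simp add: generators_def id_mem flip: A_def)
qed

text \<open>The missing direction \<open>\<i>I\<close> acts trivially.\<close>

lemma antihermitian_mem_generators:
  assumes su: "special_unitary_algebra \<subseteq> generators" and A: "antihermitian A"
  shows "A \<in> generators"
proof -
  \<comment> \<open>The trace of an anti-Hermitian operator is imaginary; \<open>r\<close> is chosen
    so that \<open>B\<close> has the same trace as \<open>A\<close>.\<close>
  define r where "r = Im (trace A) / real (CARD('n))"
  define B where "B = (\<i> * complex_of_real r) *\<^sub>c (mat 1 :: 'n operator)"
  have "cnj (A $ i $ i) = - (A $ i $ i)" for i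
    using A by (auto simp: antihermitian_def adj_def vec_eq_iff)
  then have "cnj (trace A) = - trace A" by (simp add: trace_def sum_negf)
  then have "trace A = \<i> * Im (trace A)" by (simp add: complex_eq_iff)
  moreover have "trace B = \<i> * Im (trace A)"
    by (simp add: B_def r_def trace_def cscale_def mat_def)
  ultimately have "trace (A - B) = 0" by (simp add: trace_sub)
  moreover have B: "B \<in> generators" unfolding B_def by (rule scalar_mem_generators)
  ultimately have "A - B \<in> generators"
    by (intro subsetD[OF su]) (use A in \<open>simp add: special_unitary_algebra_def generators_def antihermitian_simps\<close>)
  from generators_add[OF this B] show ?thesis by simp
qed

end

section \<open>Involutions and diagonalization\<close>

locale unitary_closed_semigroup = closed_semigroup C for C :: "('n::finite operator \<Rightarrow> 'n operator) set" +
  assumes antihermitian_mem: "antihermitian A \<Longrightarrow> A \<in> generators"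
begin

text \<open>\<open>\<i> *\<^sub>c P\<close> squares to minus the identity, so by Euler's formula it
  is its own exponential at angle \<open>pi / 2\<close>; the factor \<open>\<i>\<close> cancels in
  the conjugation.\<close>

lemma conj_map_involution_mem:
  assumes "P ** P = mat 1" "adj P = P"
  shows "conj_map P \<in> C"
proof -
  define A where "A = \<i> *\<^sub>c P"
  have "A ** A = - (P ** P)"
    by (auto simp: A_def cscale_def vec_eq_iff matrix_matrix_mult_def sum_negf[symmetric] ac_simps
        intro!: sum.cong)
  then have "op_exp ((pi / 2) *\<^sub>R A) = A" using assms by (simp add: op_exp_complex_structure)
  moreover have "antihermitian A"
    using assms(2) by (auto simp: A_def antihermitian_def adj_def cscale_def vec_eq_iff)
  ultimately have "conj_map A \<in> C"
    using conj_map_op_exp_mem[OF generators_scaleR[OF antihermitian_mem], of A "pi / 2"] by simp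
  moreover have "conj_map A = conj_map P"
  proof
    fix \<rho>
    have "A ** \<rho> ** adj A = P ** \<rho> ** adj P"
      by (simp add: A_def cscale_def adj_def vec_eq_iff matrix_matrix_mult_def sum_distrib_left
          sum_distrib_right ac_simps)
    then show "conj_map A \<rho> = conj_map P \<rho>" by (simp add: conj_map_def)
  qed
  ultimately show ?thesis by simp
qed

text \<open>
  At a maximum \<open>V\<close> of \<open>Re (trace (D ** adj V ** \<sigma> ** V))\<close>, where \<open>D\<close> is diagonal with distinct real
  entries, the derivative along the commutator \<open>A\<close> of \<open>adj V ** \<sigma> ** V\<close> and \<open>D\<close> is the sum
  of the squared moduli of the entries of \<open>A\<close>, so that the two commute.
\<close>

lemma diagonalization:
  assumes \<sigma>: "adj \<sigma> = \<sigma>"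
  obtains V where "conj_map V \<in> C" "V ** adj V = mat 1"
    "\<And>i j. i \<noteq> j \<Longrightarrow> (adj V ** \<sigma> ** V) $ i $ j = 0"
proof -
  define U where "U = {V. V ** adj V = mat 1 \<and> conj_map V \<in> C}"
  \<comment> \<open>Injectivity makes the entries of \<open>D\<close> distinct: the commutator with
    \<open>D\<close> multiplies an entry by a difference of labels, which is nonzero off the
    diagonal.\<close>
  obtain d :: "'n \<Rightarrow> nat" where d: "inj d"
    using finite_imp_inj_to_nat_seg[of "UNIV :: 'n set"] by auto
  define D :: "'n operator" where "D = (\<chi> i j. if i = j then of_nat (d i) else 0)"
  define F where "F V = Re (trace (D ** (adj V ** \<sigma> ** V)))" for V
  have bl_trace: "bounded_linear (\<lambda>X :: 'n operator. Re (trace (D ** X)))"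
    by (auto simp: linear_conv_bounded_linear[symmetric] linear_iff matrix_add_ldistrib trace_add
        matrix_mult_scaleR_right trace_def sum.distrib sum_distrib_left)
  have "compact U"
    unfolding compact_eq_bounded_closed
  proof
    \<comment> \<open>Unitarity makes the rows unit vectors, so every entry has modulus at most
      1.\<close>
    have "norm V \<le> real CARD('n) * real CARD('n)" if "V \<in> U" for V
    proof -
      have "norm (V $ i $ j) \<le> 1" for i j
      proof -
        have "(\<Sum>j\<in>UNIV. V $ i $ j * cnj (V $ i $ j)) = 1"
          using that by (simp add: U_def vec_eq_iff matrix_matrix_mult_def adj_def mat_def)
        then have "of_real (\<Sum>j\<in>UNIV. (norm (V $ i $ j))\<^sup>2) = (1 :: complex)"
          by (simp add: complex_norm_square del: of_real_power)
        then have "(\<Sum>j\<in>UNIV. (norm (V $ i $ j))\<^sup>2) = 1" by (metis of_real_eq_1_iff)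
        then have "(norm (V $ i $ j))\<^sup>2 \<le> 1"
          using member_le_sum[of j UNIV "\<lambda>j. (norm (V $ i $ j))\<^sup>2"] by simp
        then show ?thesis by (simp add: abs_square_le_1)
      qed
      then have "(\<Sum>i\<in>UNIV. \<Sum>j\<in>UNIV. norm (V $ i $ j)) \<le> (\<Sum>i\<in>(UNIV::'n set). \<Sum>j\<in>(UNIV::'n set). 1)"
        by (intro sum_mono)
      then show ?thesis using norm_le_sum_entries[of V] by simp
    qed
    then show "bounded U" by (auto simp: bounded_iff)
    show "closed U"
      unfolding closed_sequential_limits
    proof safe
      fix V W assume V: "\<forall>n. V n \<in> U" and lim: "V \<longlonglongrightarrow> W"
      have "(\<lambda>n. V n ** adj (V n)) \<longlonglongrightarrow> W ** adj W"
        by (intro matrix_mult.tendsto bounded_linear.tendsto[OF bounded_linear_adj] lim)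
      then have "W ** adj W = mat 1" using V by (simp add: U_def LIMSEQ_const_iff)
      moreover have "conj_map W \<in> C" using V lim by (auto simp: U_def intro: conj_map_limit_mem)
      ultimately show "W \<in> U" by (simp add: U_def)
    qed
  qed
  moreover have "mat 1 \<in> U" by (simp add: U_def conj_map_one id_mem)
  moreover have "continuous_on U F"
    unfolding F_def
    by (intro bounded_linear.continuous_on[OF bl_trace] matrix_mult.continuous_on continuous_on_const
        bounded_linear.continuous_on[OF bounded_linear_adj] continuous_on_id)
  ultimately obtain V where V: "V \<in> U" and max: "\<And>W. W \<in> U \<Longrightarrow> F W \<le> F V"
    using continuous_attains_sup[of U F] by blast
  define \<tau> where "\<tau> = adj V ** \<sigma> ** V"
  \<comment> \<open>The gradient direction: along an anti-Hermitian \<open>X\<close> the derivative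
    of \<open>F\<close> at \<open>V\<close> is \<open>Re (trace (adj A ** X))\<close>.\<close>
  define A where "A = \<tau> ** D - D ** \<tau>"
  have "adj \<tau> = \<tau>" by (simp add: \<tau>_def adj_mult \<sigma> matrix_mul_assoc)
  moreover have "adj D = D" by (auto simp: D_def adj_def vec_eq_iff)
  ultimately have A: "antihermitian A" by (simp add: antihermitian_def A_def adj_diff adj_mult)
  have V_exp: "V ** op_exp (t *\<^sub>R A) \<in> U" for t
  proof -
    have "V ** op_exp (t *\<^sub>R A) ** adj (V ** op_exp (t *\<^sub>R A)) =
        V ** (op_exp (t *\<^sub>R A) ** op_exp (- (t *\<^sub>R A))) ** adj V"
      by (simp add: adj_mult adj_op_exp_antihermitian antihermitian_simps A matrix_mul_assoc)
    moreover have "conj_map (V ** op_exp (t *\<^sub>R A)) \<in> C"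
      unfolding conj_map_compose[symmetric] using V antihermitian_mem[OF A]
      by (intro comp_mem) (simp_all add: U_def generators_def)
    ultimately show ?thesis using V by (simp add: U_def op_exp_minus_right)
  qed
  define g where "g t = op_exp (t *\<^sub>R (- A)) ** \<tau> ** op_exp (t *\<^sub>R A)" for t
  have g: "F (V ** op_exp (t *\<^sub>R A)) = Re (trace (D ** g t))" for t
    by (simp add: F_def g_def \<tau>_def adj_mult adj_op_exp_antihermitian antihermitian_simps A matrix_mul_assoc)
  have "(g has_vector_derivative
      (op_exp (0 *\<^sub>R (- A)) ** \<tau> ** A + (op_exp (0 *\<^sub>R (- A)) ** 0 + (- A) ** \<tau>) ** op_exp (0 *\<^sub>R A))) (at 0)"
    unfolding g_def
    by (intro matrix_mult.has_vector_derivative op_exp_has_vector_derivative_zero has_vector_derivative_const)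
  then have "(g has_vector_derivative (\<tau> ** A - A ** \<tau>)) (at 0)"
    by (simp add: matrix_mult.minus_left)
  from bounded_linear.has_vector_derivative[OF bl_trace this]
  have "DERIV (\<lambda>t. Re (trace (D ** g t))) 0 :> Re (trace (D ** (\<tau> ** A - A ** \<tau>)))"
    by (simp add: has_real_derivative_iff_has_vector_derivative)
  \<comment> \<open>Time 0 maximizes over the whole curve, so the radius 1 is arbitrary.\<close>
  then have "Re (trace (D ** (\<tau> ** A - A ** \<tau>))) = 0"
    by (rule DERIV_local_max[where d = 1])
      (use max[OF V_exp] g[of 0] in \<open>simp_all add: g[symmetric]\<close>)
  moreover have "trace (D ** (\<tau> ** A - A ** \<tau>)) = trace (adj A ** A)"
  proof -
    have "trace (D ** (A ** \<tau>)) = trace (\<tau> ** D ** A)"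
      by (metis trace_mul_sym matrix_mul_assoc)
    moreover have "adj A ** A = D ** \<tau> ** A - \<tau> ** D ** A"
      using A by (simp add: antihermitian_def A_def matrix_mult.diff_left)
    ultimately show ?thesis
      by (simp add: matrix_mult.diff_right trace_sub matrix_mul_assoc)
  qed
  moreover have "trace (adj A ** A) = of_real (\<Sum>i\<in>UNIV. \<Sum>j\<in>UNIV. (norm (A $ j $ i))\<^sup>2)"
    by (simp add: trace_def matrix_matrix_mult_def adj_def complex_norm_square mult.commute del: of_real_power)
  ultimately have "(\<Sum>i\<in>UNIV. \<Sum>j\<in>UNIV. (norm (A $ j $ i))\<^sup>2) = 0" by simp
  then have A0: "A $ j $ i = 0" for i j
    by (simp add: sum_nonneg_eq_0_iff sum_nonneg)
  have "\<tau> $ i $ j = 0" if "i \<noteq> j" for i j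
  proof -
    have "A $ i $ j = \<tau> $ i $ j * (of_nat (d j) - of_nat (d i))"
      by (simp add: A_def D_def matrix_matrix_mult_def algebra_simps if_distrib if_distribR cong: if_cong)
    then show ?thesis using A0[of i j] that d by (auto simp: inj_eq)
  qed
  then show ?thesis using V that by (auto simp: U_def \<tau>_def)
qed

end

section \<open>Damping and dephasing of single qubits\<close>

lemma num2_cases: "(x :: 2) = 0 \<or> x = 1"
  using exhaust_2[of x] by auto

lemma sums_operatorI:
  fixes X :: "nat \<Rightarrow> 'n::finite operator"
  assumes "\<And>i j. (\<lambda>n. X n $ i $ j) sums (Y $ i $ j)"
  shows "X sums Y"
  using assms unfolding sums_def
  by (intro vec_tendstoI) simp

lemma tendsto_operatorI:
  fixes X :: "'a \<Rightarrow> 'n::finite operator"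
  assumes "\<And>i j. ((\<lambda>n. X n $ i $ j) \<longlongrightarrow> Y $ i $ j) F"
  shows "(X \<longlongrightarrow> Y) F"
  using assms by (intro vec_tendstoI) simp

lemma exp_scaled_sums: "(\<lambda>n. (c ^ n *\<^sub>R z) /\<^sub>R fact n) sums (exp c *\<^sub>R (z :: complex))" for c :: real
  using bounded_linear.sums[OF bounded_linear_scaleR_left exp_converges[of c]]
  by simp

lemmas scaleR_complex = scaleR_conv_of_real[where 'a = complex]

lemma exp_decay_tendsto:
  assumes "c > 0"
  shows "(\<lambda>n. exp (- c * real n) *\<^sub>R (z :: complex)) \<longlonglongrightarrow> 0"
proof -
  have "(\<lambda>n. exp (- c) ^ n) \<longlonglongrightarrow> 0"
    using assms by (intro LIMSEQ_realpow_zero) simp_all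
  then have "(\<lambda>n. exp (- c * real n)) \<longlonglongrightarrow> 0"
    by (simp only: exp_of_nat2_mult)
  from tendsto_scaleR[OF this tendsto_const] show ?thesis by (simp only: scaleR_zero_left)
qed

lemma on_factor_nth:
  "on_factor q a $ f $ g = (if \<forall>p. p \<noteq> q \<longrightarrow> f p = g p then a $ f q $ g q else 0)"
proof -
  have "on_factor q a $ f $ g =
      a $ f q $ g q * (\<Prod>p\<in>UNIV - {q}. (if p = q then a else mat 1) $ f p $ g p)"
    unfolding on_factor_def tensor_def by (simp add: prod.remove[of UNIV q])
  also have "(\<Prod>p\<in>UNIV - {q}. (if p = q then a else mat 1) $ f p $ g p) =
      (\<Prod>p\<in>UNIV - {q}. if f p = g p then 1 else 0)"
    by (intro prod.cong) (auto simp: mat_def)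
  also have "\<dots> = (if \<forall>p. p \<noteq> q \<longrightarrow> f p = g p then 1 else 0)"
    by (auto intro!: prod.neutral prod_zero)
  finally have eq: "on_factor q a $ f $ g = a $ f q $ g q * (if \<forall>p. p \<noteq> q \<longrightarrow> f p = g p then 1 else 0)" .
  show ?thesis
  proof (cases "\<forall>p. p \<noteq> q \<longrightarrow> f p = g p")
    case True
    show ?thesis unfolding eq if_P[OF True] by simp
  next
    case False
    show ?thesis unfolding eq if_not_P[OF False] by simp
  qed
qed

lemma on_factor_pauli_Z_nth:
  "on_factor q pauli_Z $ f $ g = (if g = f then (if f q = 0 then 1 else - 1) else 0)"
proof (cases "g = f")
  case True
  have "on_factor q pauli_Z $ f $ f = pauli_Z $ f q $ f q" by (simp add: on_factor_nth)
  then show ?thesis using True num2_cases[of "f q"] by (auto simp: pauli_Z_def ketbra_def)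
next
  case False
  have "on_factor q pauli_Z $ f $ g = 0"
  proof (cases "\<forall>p. p \<noteq> q \<longrightarrow> f p = g p")
    case True
    then have "f q \<noteq> g q" using False by (metis ext)
    then show ?thesis by (auto simp: on_factor_nth pauli_Z_def ketbra_def)
  next
    case False
    show ?thesis unfolding on_factor_nth if_not_P[OF False] ..
  qed
  then show ?thesis using False by simp
qed

text \<open>Writing the entry as a delta in the column index lets the sums in matrix products
  collapse to one term.\<close>

lemma on_factor_lowering_nth:
  "on_factor q (ketbra 0 1) $ f $ g = (if g = f(q := 1) then (if f q = 0 then 1 else 0) else 0)"
proof (cases "g = f(q := 1)")
  case True
  then show ?thesis by (simp add: on_factor_nth ketbra_def)
next
  case False
  have "on_factor q (ketbra 0 1) $ f $ g = 0"
  proof (cases "\<forall>p. p \<noteq> q \<longrightarrow> f p = g p")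
    case True
    then have "g q \<noteq> 1" using False by (metis ext fun_upd_apply)
    then show ?thesis by (simp add: on_factor_nth ketbra_def)
  next
    case False
    show ?thesis unfolding on_factor_nth if_not_P[OF False] ..
  qed
  then show ?thesis using False by simp
qed

text \<open>The pinching to operators that are block diagonal with respect to the labels of the
  qubits in \<open>Q\<close>.\<close>

definition dephase :: "'q::finite set \<Rightarrow> 'q qubits_operator \<Rightarrow> 'q qubits_operator" where
  "dephase Q \<rho> = (\<chi> f g. if \<forall>q\<in>Q. f q = g q then \<rho> $ f $ g else 0)"

text \<open>The partial trace over qubit \<open>q\<close>, tensored with the projector onto its
  state 0.\<close>

definition reset :: "'q::finite \<Rightarrow> 'q qubits_operator \<Rightarrow> 'q qubits_operator" where
  "reset q \<rho> = (\<chi> f g. if f q = 0 \<and> g q = 0 then \<rho> $ f $ g + \<rho> $ (f(q := 1)) $ (g(q := 1)) else 0)"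

text \<open>The jump operator \<open>a\<close> is a self-adjoint involution, so the generator is
  \<open>2 (a \<rho> a - \<rho>)\<close>: it vanishes on an entry where the two signs agree and
  gives the factor \<open>- 4\<close> where they differ.\<close>

lemma lindblad_pauli_Z:
  "lindblad (on_factor q pauli_Z) \<rho> = (\<chi> f g. if f q = g q then 0 else - 4 * \<rho> $ f $ g)"
proof -
  define a where "a = on_factor q pauli_Z"
  have a: "a $ f $ g = (if g = f then (if f q = 0 then 1 else - 1) else 0)" for f g
    by (simp add: a_def on_factor_pauli_Z_nth)
  have adj: "adj a = a" by (auto simp: adj_def a vec_eq_iff)
  have left: "(a ** B) $ f $ g = (if f q = 0 then 1 else - 1) * B $ f $ g"
    and right: "(B ** a) $ f $ g = (if g q = 0 then 1 else - 1) * B $ f $ g" for B f g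
    by (simp_all add: matrix_matrix_mult_def a mult_delta_left mult_delta_right)
  have "lindblad a \<rho> $ f $ g = (if f q = g q then 0 else - 4 * \<rho> $ f $ g)" for f g
    unfolding lindblad_def adj matrix_mul_assoc[symmetric, of a a \<rho>]
    using num2_cases[of "f q"] num2_cases[of "g q"] by (auto simp: left right scaleR_complex)
  then show ?thesis by (simp add: vec_eq_iff a_def)
qed

lemma superop_exp_pauli_Z:
  "superop_exp (\<lambda>\<rho>. t *\<^sub>R lindblad (on_factor q pauli_Z) \<rho>) \<rho> =
    (\<chi> f g. if f q = g q then \<rho> $ f $ g else exp (- 4 * t) *\<^sub>R \<rho> $ f $ g)"
proof -
  define c where "c f g = (if f q = g q then 0 else - 4 * t)" for f g :: "'a \<Rightarrow> 2"
  \<comment> \<open>Every entry evolves separately. For equal labels the rate is 0, and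
    \<open>0 ^ 0 = 1\<close> keeps the entry.\<close>
  have pow: "((\<lambda>\<rho>. t *\<^sub>R lindblad (on_factor q pauli_Z) \<rho>) ^^ n) \<rho> $ f $ g = c f g ^ n *\<^sub>R \<rho> $ f $ g" for n f g
    by (induction n) (simp_all add: lindblad_pauli_Z c_def scaleR_complex)
  have "(\<lambda>n. ((\<lambda>\<rho>. t *\<^sub>R lindblad (on_factor q pauli_Z) \<rho>) ^^ n) \<rho> /\<^sub>R fact n) sums
      (\<chi> f g. exp (c f g) *\<^sub>R \<rho> $ f $ g)"
    using exp_scaled_sums by (intro sums_operatorI) (simp add: pow)
  moreover have "(\<chi> f g. exp (c f g) *\<^sub>R \<rho> $ f $ g) =
      (\<chi> f g. if f q = g q then \<rho> $ f $ g else exp (- 4 * t) *\<^sub>R \<rho> $ f $ g)"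
    by (auto simp: vec_eq_iff c_def)
  ultimately show ?thesis
    unfolding superop_exp_def by (simp only: sums_unique[symmetric])
qed

lemma superop_exp_pauli_Z_tendsto:
  "(\<lambda>n. superop_exp (\<lambda>\<rho>. real n *\<^sub>R lindblad (on_factor q pauli_Z) \<rho>) \<rho>) \<longlonglongrightarrow> dephase {q} \<rho>"
proof (rule tendsto_operatorI)
  fix f g
  have "(\<lambda>n. exp (- 4 * real n) *\<^sub>R \<rho> $ f $ g) \<longlonglongrightarrow> 0"
    by (rule exp_decay_tendsto) simp
  then show "(\<lambda>n. superop_exp (\<lambda>\<rho>. real n *\<^sub>R lindblad (on_factor q pauli_Z) \<rho>) \<rho> $ f $ g)
      \<longlonglongrightarrow> dephase {q} \<rho> $ f $ g"
    unfolding superop_exp_pauli_Z dephase_def by (cases "f q = g q") simp_all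
qed

lemma lindblad_lowering:
  "lindblad (on_factor q (ketbra 0 1)) \<rho> =
    (\<chi> f g. (if f q = 0 \<and> g q = 0 then 2 * \<rho> $ (f(q := 1)) $ (g(q := 1)) else 0)
      - ((if f q = 1 then 1 else 0) + (if g q = 1 then 1 else 0)) * \<rho> $ f $ g)"
proof -
  define a where "a = on_factor q (ketbra 0 1)"
  have a: "a $ f $ g = (if g = f(q := 1) then (if f q = 0 then 1 else 0) else 0)" for f g
    by (simp add: a_def on_factor_lowering_nth)
  have left: "(a ** B) $ f $ g = (if f q = 0 then B $ (f(q := 1)) $ g else 0)" for B f g
    by (simp add: matrix_matrix_mult_def a mult_delta_left)
  have cnj_a: "cnj (a $ f $ g) = a $ f $ g" for f g by (simp add: a)
  have right: "(B ** adj a) $ f $ g = (if g q = 0 then B $ f $ (g(q := 1)) else 0)" for B f g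
    unfolding matrix_matrix_mult_def adj_def vec_lambda_beta cnj_a by (simp add: a mult_delta_right)
  \<comment> \<open>The same entries as a delta in the row index, the form that collapses
    \<open>adj a ** B\<close> and \<open>B ** a\<close>.\<close>
  have a': "a $ h $ f = (if h = f(q := 0) then (if f q = 1 then 1 else 0) else 0)" for f h
  proof -
    have "a $ h $ f = (if f = h(q := 1) \<and> h q = 0 then 1 else 0)" by (simp add: a)
    also have "f = h(q := 1) \<and> h q = 0 \<longleftrightarrow> h = f(q := 0) \<and> f q = 1"
      by (metis fun_upd_triv fun_upd_upd fun_upd_same)
    finally show ?thesis by simp
  qed
  have left': "(adj a ** B) $ f $ g = (if f q = 1 then B $ (f(q := 0)) $ g else 0)" for B f g
    unfolding matrix_matrix_mult_def adj_def vec_lambda_beta cnj_a by (simp add: a' mult_delta_left)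
  have right': "(B ** a) $ f $ g = (if g q = 1 then B $ f $ (g(q := 0)) else 0)" for B f g
    by (simp add: matrix_matrix_mult_def a' mult_delta_right)
  have "lindblad a \<rho> $ f $ g = (if f q = 0 \<and> g q = 0 then 2 * \<rho> $ (f(q := 1)) $ (g(q := 1)) else 0)
      - ((if f q = 1 then 1 else 0) + (if g q = 1 then 1 else 0)) * \<rho> $ f $ g" for f g
    unfolding lindblad_def matrix_mul_assoc[symmetric, of "adj a" a \<rho>]
    by (simp add: left right left' right' fun_upd_idem scaleR_complex)
  then show ?thesis by (simp add: vec_eq_iff a_def)
qed

text \<open>The generator is triangular. An entry with a label 1 at \<open>q\<close> decays by
  itself, at rate 2 if both labels are 1 and at rate 1 otherwise; an entry with both labels 0
  collects what its partner with both labels 1 loses.\<close>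

lemma superop_exp_lowering:
  "superop_exp (\<lambda>\<rho>. t *\<^sub>R lindblad (on_factor q (ketbra 0 1)) \<rho>) \<rho> =
    (\<chi> f g. if f q = 0 \<and> g q = 0
      then \<rho> $ f $ g + \<rho> $ (f(q := 1)) $ (g(q := 1)) - exp (- 2 * t) *\<^sub>R \<rho> $ (f(q := 1)) $ (g(q := 1))
      else exp (- (if f q = 1 \<and> g q = 1 then 2 else 1) * t) *\<^sub>R \<rho> $ f $ g)"
    (is "_ = ?E")
proof -
  define L where "L = (\<lambda>\<rho>. t *\<^sub>R lindblad (on_factor q (ketbra 0 1)) \<rho>)"
  define c where "c f g = - (if f q = 1 \<and> g q = 1 then 2 else 1) * t" for f g :: "'a \<Rightarrow> 2"
  have pow: "(L ^^ n) \<rho> $ f $ g = c f g ^ n *\<^sub>R \<rho> $ f $ g" if "\<not> (f q = 0 \<and> g q = 0)" for n f g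
    using num2_cases[of "f q"] num2_cases[of "g q"] that
    by (induction n) (auto simp: L_def lindblad_lowering c_def scaleR_complex)
  \<comment> \<open>\<open>0 ^ n\<close> singles out \<open>n = 0\<close> and contributes
    \<open>exp 0 = 1\<close> to the sum, so the closed form is a difference of two exponential
    series.\<close>
  have pow0: "(L ^^ n) \<rho> $ f $ g = 0 ^ n *\<^sub>R (\<rho> $ f $ g + \<rho> $ (f(q := 1)) $ (g(q := 1)))
      - (- 2 * t) ^ n *\<^sub>R \<rho> $ (f(q := 1)) $ (g(q := 1))" if "f q = 0" "g q = 0" for n f g
  proof (cases n)
    case (Suc m)
    have "(L ^^ Suc m) \<rho> $ f $ g = (2 * t) *\<^sub>R (L ^^ m) \<rho> $ (f(q := 1)) $ (g(q := 1))"
      using that by (simp add: L_def lindblad_lowering scaleR_complex)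
    then show ?thesis by (simp add: Suc pow c_def)
  qed simp
  have "(\<lambda>n. (L ^^ n) \<rho> /\<^sub>R fact n) sums ?E"
  proof (rule sums_operatorI)
    fix f g
    show "(\<lambda>n. ((L ^^ n) \<rho> /\<^sub>R fact n) $ f $ g) sums (?E $ f $ g)"
    proof (cases "f q = 0 \<and> g q = 0")
      case True
      then show ?thesis
        using sums_diff[OF exp_scaled_sums[of 0] exp_scaled_sums[of "- 2 * t"]]
        by (simp add: pow0 scaleR_diff_right)
    next
      case False
      have "?E $ f $ g = exp (c f g) *\<^sub>R \<rho> $ f $ g"
        unfolding vec_lambda_beta if_not_P[OF False] c_def ..
      then show ?thesis using exp_scaled_sums[of "c f g" "\<rho> $ f $ g"] by (simp add: pow[of f g, OF False])
    qed
  qed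
  then show ?thesis unfolding superop_exp_def L_def by (rule sums_unique[symmetric])
qed

lemma superop_exp_lowering_tendsto:
  "(\<lambda>n. superop_exp (\<lambda>\<rho>. real n *\<^sub>R lindblad (on_factor q (ketbra 0 1)) \<rho>) \<rho>) \<longlonglongrightarrow> reset q \<rho>"
proof (rule tendsto_operatorI)
  fix f g
  show "(\<lambda>n. superop_exp (\<lambda>\<rho>. real n *\<^sub>R lindblad (on_factor q (ketbra 0 1)) \<rho>) \<rho> $ f $ g)
      \<longlonglongrightarrow> reset q \<rho> $ f $ g"
  proof (cases "f q = 0 \<and> g q = 0")
    case True
    show ?thesis
      unfolding superop_exp_lowering reset_def vec_lambda_beta if_P[OF True]
      using tendsto_diff[OF tendsto_const exp_decay_tendsto[of 2]] by simp
  next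
    case False
    show ?thesis
      unfolding superop_exp_lowering reset_def vec_lambda_beta if_not_P[OF False]
      by (rule exp_decay_tendsto) simp
  qed
qed

lemma dephase_insert: "dephase (insert q Q) = dephase {q} \<circ> dephase Q"
  by (auto simp: dephase_def fun_eq_iff vec_eq_iff)

text \<open>This invariant later determines the only entry that survives all resets.\<close>

lemma trace_reset: "trace (reset q \<rho>) = trace \<rho>"
proof -
  have "trace (reset q \<rho>) = (\<Sum>f | f q = 0. \<rho> $ f $ f + \<rho> $ (f(q := 1)) $ (f(q := 1)))"
    unfolding trace_def reset_def by (simp add: sum.If_cases)
  also have "\<dots> = (\<Sum>f | f q = 0. \<rho> $ f $ f) + (\<Sum>f | f q = 0. \<rho> $ (f(q := 1)) $ (f(q := 1)))"
    by (rule sum.distrib)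
  also have "(\<Sum>f | f q = 0. \<rho> $ (f(q := 1)) $ (f(q := 1))) = (\<Sum>f | f q = 1. \<rho> $ f $ f)"
    by (rule sum.reindex_bij_witness[of _ "\<lambda>f. f(q := 0)" "\<lambda>f. f(q := 1)"]) auto
  also have "{f. f q = 1} = - {f :: 'a \<Rightarrow> 2. f q = 0}"
    using num2_cases by auto
  also have "(\<Sum>f | f q = 0. \<rho> $ f $ f) + (\<Sum>f\<in>- {f. f q = 0}. \<rho> $ f $ f) = trace \<rho>"
    unfolding trace_def using sum.subset_diff[of "{f. f q = 0}" UNIV "\<lambda>f. \<rho> $ f $ f"]
    by (simp add: Compl_eq_Diff_UNIV add.commute)
  finally show ?thesis .
qed

section \<open>Exchanging qubits\<close>

definition swap :: "'q \<Rightarrow> 'q \<Rightarrow> ('q \<Rightarrow> 2) \<Rightarrow> ('q \<Rightarrow> 2)" where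
  "swap p q f = f(p := f q, q := f p)"

lemma swap_swap [simp]: "swap p q (swap p q f) = f"
  by (auto simp: swap_def fun_eq_iff)

lemma swap_eq_iff: "g = swap p q f \<longleftrightarrow> f = swap p q g"
  by auto

definition swap_op :: "'q::finite \<Rightarrow> 'q \<Rightarrow> 'q qubits_operator" where
  "swap_op p q = (\<chi> f g. if g = swap p q f then 1 else 0)"

lemma adj_swap_op: "adj (swap_op p q) = swap_op p q"
  by (auto simp: adj_def swap_op_def vec_eq_iff)

lemma swap_op_mult: "(swap_op p q ** B) $ f $ g = B $ swap p q f $ g"
  and mult_swap_op: "(B ** swap_op p q) $ f $ g = B $ f $ swap p q g"
  by (simp add: matrix_matrix_mult_def swap_op_def mult_delta_left)
     (simp add: matrix_matrix_mult_def swap_op_def swap_eq_iff[of g] mult_delta_right)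

lemma swap_op_involution: "swap_op p q ** swap_op p q = mat 1"
  by (auto simp: vec_eq_iff swap_op_mult) (auto simp: swap_op_def mat_def)

lemma conj_map_swap_op: "conj_map (swap_op p q) \<rho> $ f $ g = \<rho> $ swap p q f $ swap p q g"
  by (simp add: conj_map_def adj_swap_op swap_op_mult mult_swap_op)

text \<open>Since \<open>swap q q\<close> is the identity, the case \<open>p = q\<close> is
  included, here and in \<open>reset_swap\<close>.\<close>

lemma dephase_swap:
  "dephase {q} = conj_map (swap_op p q) \<circ> (dephase {p} \<circ> conj_map (swap_op p q))"
proof
  fix \<rho>
  have "swap p q f p = f q" for f by (simp add: swap_def)
  then show "dephase {q} \<rho> = (conj_map (swap_op p q) \<circ> (dephase {p} \<circ> conj_map (swap_op p q))) \<rho>"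
    by (simp add: vec_eq_iff conj_map_swap_op) (simp add: dephase_def conj_map_swap_op)
qed

lemma reset_swap:
  "reset q = conj_map (swap_op p q) \<circ> (reset p \<circ> conj_map (swap_op p q))"
proof
  fix \<rho>
  have "swap p q f p = f q" "swap p q ((swap p q f)(p := 1)) = f(q := 1)" for f
    by (auto simp: swap_def fun_eq_iff)
  then show "reset q \<rho> = (conj_map (swap_op p q) \<circ> (reset p \<circ> conj_map (swap_op p q))) \<rho>"
    by (simp add: vec_eq_iff conj_map_swap_op) (simp add: reset_def conj_map_swap_op)
qed

section \<open>Transitivity\<close>

text \<open>The rank-one operator of a real vector. The amplitudes that occur are 0, 1 and square
  roots of probabilities, which keeps the reflection between them real symmetric.\<close>

definition pure_op :: "('n::finite \<Rightarrow> real) \<Rightarrow> 'n operator" where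
  "pure_op u = (\<chi> i j. complex_of_real (u i * u j))"

context unitary_closed_semigroup
begin

text \<open>The Householder reflection exchanging the two unit vectors.\<close>

lemma basis_state_to_pure_state:
  fixes u :: "'n \<Rightarrow> real"
  assumes u: "(\<Sum>i\<in>UNIV. (u i)\<^sup>2) = 1"
  obtains \<Phi> where "\<Phi> \<in> C" "\<Phi> (pure_op (\<lambda>i. if i = z then 1 else 0)) = pure_op u"
proof (cases "u = (\<lambda>i. if i = z then 1 else 0)")
  \<comment> \<open>Here the difference of the two vectors vanishes and defines no
    reflection.\<close>
  case True
  then show ?thesis using that[OF id_mem] by simp
next
  case False
  define w where "w i = u i - (if i = z then 1 else 0)" for i
  define W where "W = (\<Sum>i\<in>UNIV. (w i)\<^sup>2)"
  define c where "c = 2 / W"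
  have "(w i)\<^sup>2 = (u i)\<^sup>2 + (if i = z then 1 - 2 * u i else 0)" for i
    by (simp add: w_def power2_eq_square algebra_simps)
  \<comment> \<open>Both vectors have norm 1, so the squared norm of their difference is
    \<open>2 - 2 * u z\<close>.\<close>
  then have W: "W = - 2 * w z"
    unfolding W_def by (simp add: sum.distrib u) (simp add: w_def)
  have "W \<noteq> 0"
  proof
    assume "W = 0"
    then have "w i = 0" for i by (simp add: W_def sum_nonneg_eq_0_iff)
    then show False using False by (auto simp: w_def fun_eq_iff)
  qed
  \<comment> \<open>The first equation makes \<open>P\<close> an involution; by the second,
    \<open>P\<close> maps the basis vector at \<open>z\<close> to itself plus \<open>w\<close>,
    which is \<open>u\<close>.\<close>
  then have cW: "c * W = 2" and cw: "c * w z = - 1" by (simp_all add: c_def W)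
  define P :: "'n operator" where
    "P = (\<chi> i j. complex_of_real ((if i = j then 1 else 0) - c * w i * w j))"
  have adj: "adj P = P" by (auto simp: adj_def P_def vec_eq_iff)
  have "(P ** P) $ i $ j = mat 1 $ i $ j" for i j
  proof -
    have "(\<Sum>k\<in>UNIV. ((if i = k then 1 else 0) - c * w i * w k) * ((if k = j then 1 else 0) - c * w k * w j)) =
        (\<Sum>k\<in>UNIV. (if k = j then (if i = k then 1 else 0) - c * w i * w k else 0)
          - (if i = k then c * w k * w j else 0) + c * w i * (c * w j) * (w k)\<^sup>2)"
      by (intro sum.cong) (auto simp: algebra_simps power2_eq_square)
    also have "\<dots> = (if i = j then 1 else 0) - 2 * (c * w i * w j) + c * w i * (c * w j) * W"
      unfolding W_def by (simp add: sum.distrib sum_subtractf sum_distrib_left)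
    also have "c * w i * (c * w j) * W = 2 * (c * w i * w j)"
      using cW by (simp add: algebra_simps)
    finally have "(\<Sum>k\<in>UNIV. ((if i = k then 1 else 0) - c * w i * w k) * ((if k = j then 1 else 0) - c * w k * w j)) =
        (if i = j then 1 else 0)" by simp
    then show ?thesis
      unfolding matrix_matrix_mult_def P_def mat_def vec_lambda_beta of_real_mult[symmetric] of_real_sum[symmetric]
      by simp
  qed
  then have "P ** P = mat 1" by (simp add: vec_eq_iff)
  then have mem: "conj_map P \<in> C" using adj by (rule conj_map_involution_mem)
  have Pz: "P $ i $ z = complex_of_real (u i)" "P $ z $ i = complex_of_real (u i)" for i
  proof -
    have "c * w i * w z = (c * w z) * w i" by simp
    then have "c * w i * w z = - w i" "c * w z * w i = - w i" by (simp_all add: cw)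
    then have "(if i = z then 1 else 0) - c * w i * w z = u i"
      "(if z = i then 1 else 0) - c * w z * w i = u i"
      unfolding w_def by auto
    then show "P $ i $ z = complex_of_real (u i)" "P $ z $ i = complex_of_real (u i)"
      unfolding P_def vec_lambda_beta by (simp_all only:)
  qed
  define E :: "'n operator" where "E = pure_op (\<lambda>i. if i = z then 1 else 0)"
  have E: "E $ i $ j = (if i = z then (if j = z then 1 else 0) else 0)" for i j
    by (simp add: E_def pure_op_def)
  have PE: "(P ** E) $ i $ j = (if j = z then P $ i $ z else 0)" for i j
    by (simp add: matrix_matrix_mult_def E mult_delta_right)
  have "(P ** E ** P) $ i $ j = P $ i $ z * P $ z $ j" for i j
    unfolding matrix_matrix_mult_def[of "P ** E"] by (simp add: PE mult_delta_left)
  then have "conj_map P E = pure_op u"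
    by (simp add: vec_eq_iff conj_map_def adj pure_op_def Pz)
  then show ?thesis using mem that unfolding E_def by blast
qed

end

section \<open>Reaching an arbitrary state\<close>

locale qubit_channels = unitary_closed_semigroup C
  for C :: "('q::finite qubits_operator \<Rightarrow> 'q qubits_operator) set" +
  fixes first :: 'q
  assumes lowering_mem: "0 \<le> t \<Longrightarrow> superop_exp (\<lambda>\<rho>. t *\<^sub>R lindblad (on_factor first (ketbra 0 1)) \<rho>) \<in> C"
    and pauli_Z_mem: "0 \<le> t \<Longrightarrow> superop_exp (\<lambda>\<rho>. t *\<^sub>R lindblad (on_factor first pauli_Z) \<rho>) \<in> C"
begin

lemma swap_mem: "conj_map (swap_op p q) \<in> C"
  by (intro conj_map_involution_mem swap_op_involution adj_swap_op)

lemma dephase_one_mem: "dephase {q} \<in> C"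
proof -
  have "dephase {first} \<in> C"
    by (rule limit_mem[OF pauli_Z_mem superop_exp_pauli_Z_tendsto]) simp
  then show ?thesis
    unfolding dephase_swap[of q first] by (intro comp_mem swap_mem)
qed

lemma dephase_mem: "dephase Q \<in> C"
proof (induction Q rule: infinite_finite_induct)
  case empty
  have "dephase {} = (id :: 'q qubits_operator \<Rightarrow> _)" by (auto simp: dephase_def fun_eq_iff vec_eq_iff)
  then show ?case using id_mem by (simp only:)
next
  case (insert q Q)
  show ?case unfolding dephase_insert[of q Q] by (rule comp_mem[OF dephase_one_mem insert.IH])
qed simp

lemma reset_mem: "reset q \<in> C"
proof -
  have "reset first \<in> C"
    by (rule limit_mem[OF lowering_mem superop_exp_lowering_tendsto]) simp
  then show ?thesis
    unfolding reset_swap[of q first] by (intro comp_mem swap_mem)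
qed

text \<open>The existential avoids fixing an order of the resets; the vanishing of entries is the
  invariant that accumulates.\<close>

lemma reset_set_mem:
  "\<exists>\<Phi>\<in>C. \<forall>\<rho>. trace (\<Phi> \<rho>) = trace \<rho> \<and> (\<forall>f g. \<forall>q\<in>Q. f q \<noteq> 0 \<or> g q \<noteq> 0 \<longrightarrow> \<Phi> \<rho> $ f $ g = 0)"
proof (induction Q rule: infinite_finite_induct)
  case empty
  show ?case using id_mem by (intro bexI[of _ id]) simp_all
next
  case (insert q Q)
  then obtain \<Phi> where \<Phi>: "\<Phi> \<in> C" "\<And>\<rho>. trace (\<Phi> \<rho>) = trace \<rho>"
    "\<And>\<rho> f g p. p \<in> Q \<Longrightarrow> f p \<noteq> 0 \<or> g p \<noteq> 0 \<Longrightarrow> \<Phi> \<rho> $ f $ g = 0"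
    by metis
  show ?case
  proof (intro bexI[of _ "reset q \<circ> \<Phi>"] allI conjI ballI impI)
    show "reset q \<circ> \<Phi> \<in> C" by (rule comp_mem[OF reset_mem \<Phi>(1)])
    show "trace ((reset q \<circ> \<Phi>) \<rho>) = trace \<rho>" for \<rho> by (simp add: trace_reset \<Phi>(2))
    fix \<rho> and f g :: "'q \<Rightarrow> 2" and p
    assume p: "p \<in> insert q Q" "f p \<noteq> 0 \<or> g p \<noteq> 0"
    show "(reset q \<circ> \<Phi>) \<rho> $ f $ g = 0"
    proof (cases "p = q")
      case False
      \<comment> \<open>\<open>reset q\<close> combines only entries with unchanged labels at
        \<open>p\<close>, so the zeros obtained for \<open>p\<close> survive.\<close>
      then have "\<Phi> \<rho> $ f $ g = 0" "\<Phi> \<rho> $ (f(q := 1)) $ (g(q := 1)) = 0"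
        using p by (auto intro!: \<Phi>(3)[of p])
      then show ?thesis by (simp add: reset_def)
    qed (use p in \<open>auto simp: reset_def\<close>)
  qed
qed simp

lemma reset_to_basis_state:
  obtains \<Phi> where "\<Phi> \<in> C"
    "\<And>\<rho>. trace \<rho> = 1 \<Longrightarrow> \<Phi> \<rho> = pure_op (\<lambda>f. if f = (\<lambda>_. 0) then 1 else 0)"
proof -
  obtain \<Phi> where \<Phi>: "\<Phi> \<in> C" "\<And>\<rho>. trace (\<Phi> \<rho>) = trace \<rho>"
    "\<And>\<rho> f g q. f q \<noteq> 0 \<or> g q \<noteq> 0 \<Longrightarrow> \<Phi> \<rho> $ f $ g = 0"
    using reset_set_mem[of UNIV] by (metis UNIV_I)
  have "\<Phi> \<rho> = pure_op (\<lambda>f. if f = (\<lambda>_. 0) then 1 else 0)" if "trace \<rho> = 1" for \<rho>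
  proof -
    have off: "\<Phi> \<rho> $ f $ g = 0" if "f \<noteq> (\<lambda>_. 0) \<or> g \<noteq> (\<lambda>_. 0)" for f g
      using that \<Phi>(3) by (meson ext)
    have "trace (\<Phi> \<rho>) = (\<Sum>f\<in>(UNIV :: ('q \<Rightarrow> 2) set). if f = (\<lambda>_. 0) then \<Phi> \<rho> $ (\<lambda>_. 0) $ (\<lambda>_. 0) else 0)"
      unfolding trace_def by (intro sum.cong) (auto simp: off)
    then have "\<Phi> \<rho> $ (\<lambda>_. 0) $ (\<lambda>_. 0) = 1" using \<Phi>(2) that by simp
    then show ?thesis by (auto simp: vec_eq_iff pure_op_def off)
  qed
  then show ?thesis using \<Phi>(1) that by blast
qed

lemma reaches_state:
  assumes \<sigma>: "\<sigma> \<in> states"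
  obtains \<Phi> where "\<Phi> \<in> C" "\<And>\<rho>. trace \<rho> = 1 \<Longrightarrow> \<Phi> \<rho> = \<sigma>"
proof -
  have "adj \<sigma> = \<sigma>" "positive_op \<sigma>" "trace \<sigma> = 1" using \<sigma> by (simp_all add: states_def)
  then obtain V where V: "conj_map V \<in> C" "V ** adj V = mat 1"
    and diag: "\<And>f g. f \<noteq> g \<Longrightarrow> (adj V ** \<sigma> ** V) $ f $ g = 0"
    using diagonalization by blast
  define \<tau> where "\<tau> = adj V ** \<sigma> ** V"
  define p where "p f = Re (\<tau> $ f $ f)" for f
  have nonneg: "\<tau> $ f $ f \<in> \<real>\<^sub>\<ge>\<^sub>0" for f
  proof -
    \<comment> \<open>The diagonal entry is the quadratic form of \<open>\<sigma>\<close> at column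
      \<open>f\<close> of \<open>V\<close>.\<close>
    have "\<tau> $ f $ f = (\<Sum>i\<in>UNIV. cnj ((\<chi> i. V $ i $ f) $ i) * (\<sigma> *v (\<chi> i. V $ i $ f)) $ i)"
      unfolding \<tau>_def matrix_mul_assoc[symmetric]
      by (simp add: matrix_matrix_mult_def matrix_vector_mult_def adj_def)
    then show ?thesis
      using \<open>positive_op \<sigma>\<close>[unfolded positive_op_def, THEN spec, of "\<chi> i. V $ i $ f"] by (simp only:)
  qed
  have p: "p f \<ge> 0" "\<tau> $ f $ f = complex_of_real (p f)" for f
    using nonneg[of f] unfolding p_def complex_nonneg_Reals_iff by (simp_all add: complex_eq_iff)
  have "trace \<tau> = trace (V ** (adj V ** \<sigma>))"
    unfolding \<tau>_def by (rule trace_mul_sym)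
  then have "trace \<tau> = 1" by (simp add: matrix_mul_assoc V(2) \<open>trace \<sigma> = 1\<close>)
  then have "Re (\<Sum>f\<in>UNIV. \<tau> $ f $ f) = 1" by (simp add: trace_def)
  then have "(\<Sum>f\<in>UNIV. p f) = 1" by (simp add: p_def)
  then have "(\<Sum>f\<in>UNIV. (sqrt (p f))\<^sup>2) = 1" by (simp add: p(1))
  then obtain \<Psi> where \<Psi>: "\<Psi> \<in> C" "\<Psi> (pure_op (\<lambda>f. if f = (\<lambda>_. 0) then 1 else 0)) = pure_op (\<lambda>f. sqrt (p f))"
    by (rule basis_state_to_pure_state)
  have dephased: "dephase UNIV (pure_op (\<lambda>f. sqrt (p f))) = \<tau>"
  proof -
    have "dephase UNIV (pure_op (\<lambda>f. sqrt (p f))) $ f $ g = \<tau> $ f $ g" for f g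
    proof (cases "f = g")
      case True
      then show ?thesis using p[of g] by (simp add: dephase_def pure_op_def flip: of_real_mult)
    next
      case False
      then have "\<not> (\<forall>q\<in>UNIV. f q = g q)" by (auto simp: fun_eq_iff)
      then have "dephase UNIV (pure_op (\<lambda>f. sqrt (p f))) $ f $ g = 0"
        unfolding dephase_def vec_lambda_beta by (rule if_not_P)
      then show ?thesis using diag[OF False] by (simp add: \<tau>_def)
    qed
    then show ?thesis by (simp add: vec_eq_iff)
  qed
  have rotated: "conj_map V \<tau> = \<sigma>"
  proof -
    have "conj_map V \<tau> = (V ** adj V) ** \<sigma> ** (V ** adj V)"
      by (simp add: conj_map_def \<tau>_def matrix_mul_assoc)
    then show ?thesis by (simp add: V)
  qed
  obtain \<Phi> where \<Phi>: "\<Phi> \<in> C"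
    "\<And>\<rho>. trace \<rho> = 1 \<Longrightarrow> \<Phi> \<rho> = pure_op (\<lambda>f. if f = (\<lambda>_. 0) then 1 else 0)"
    using reset_to_basis_state by blast
  show ?thesis
  proof (rule that)
    show "conj_map V \<circ> (dephase UNIV \<circ> (\<Psi> \<circ> \<Phi>)) \<in> C"
      by (intro comp_mem V(1) dephase_mem \<Psi>(1) \<Phi>(1))
    show "(conj_map V \<circ> (dephase UNIV \<circ> (\<Psi> \<circ> \<Phi>))) \<rho> = \<sigma>" if "trace \<rho> = 1" for \<rho>
      by (simp add: \<Phi>(2)[OF that] \<Psi>(2) dephased rotated)
  qed
qed

end

section \<open>From the resource set to the abstract semigroup\<close>

lemma channel_class_closed_channels: "channel_class S (closed_channels S)"
  \<comment> \<open>Each of the four clauses is inherited by intersections.\<close>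
  unfolding channel_class_def closed_channels_def by (auto intro!: closed_Inter)

lemma closed_semigroup_closed_channels: "closed_semigroup (closed_channels S)"
proof -
  note cc = channel_class_closed_channels[of S, unfolded channel_class_def]
  \<comment> \<open>The identity is the evolution under the zero Hamiltonian, whose multiple 0 lies
    in every span.\<close>
  have "(\<lambda>\<rho>. op_exp ((\<i> * complex_of_real 0) *\<^sub>c 0) ** \<rho> **
      op_exp ((- \<i> * complex_of_real 0) *\<^sub>c 0)) \<in> closed_channels S"
    by (rule cc[THEN conjunct1, rule_format]) (simp add: antihermitian_simps cop.span_zero)
  then have "(\<lambda>\<rho>. \<rho>) \<in> closed_channels S" by simp
  then show ?thesis
    using cc by unfold_locales (auto simp: id_def)
qed

lemma span_subset_generators:
  "{A \<in> cop.span S. antihermitian A} \<subseteq> closed_semigroup.generators (closed_channels S)"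
proof
  interpret closed_semigroup "closed_channels S" by (rule closed_semigroup_closed_channels)
  note cc = channel_class_closed_channels[of S, unfolded channel_class_def]
  have forward: "conj_map (op_exp (t *\<^sub>R A)) \<in> closed_channels S"
    if A: "A \<in> cop.span S" "antihermitian A" and t: "0 \<le> t" for A t
  proof -
    \<comment> \<open>The unitary clause speaks of Hamiltonians, so
      \<open>\<i> *\<^sub>c H = A\<close> is solved for \<open>H\<close>.\<close>
    define H where "H = (- \<i>) *\<^sub>c A"
    have i_mult: "\<i> * x * (\<i> * y) = - (x * y)" for x y by (simp add: complex_eq_iff)
    have H: "\<i> *\<^sub>c H = A" "(\<i> * complex_of_real t) *\<^sub>c H = t *\<^sub>R A"
      "(- \<i> * complex_of_real t) *\<^sub>c H = - (t *\<^sub>R A)"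
      by (simp_all add: H_def cscale_def vec_eq_iff scaleR_complex i_mult)
    have "conj_map (op_exp (t *\<^sub>R A)) = (\<lambda>\<rho>. op_exp ((\<i> * complex_of_real t) *\<^sub>c H) ** \<rho> **
        op_exp ((- \<i> * complex_of_real t) *\<^sub>c H))"
      unfolding H by (rule ext) (simp add: conj_map_def adj_op_exp_antihermitian antihermitian_simps A)
    also have "\<dots> \<in> closed_channels S"
      using cc A t H(1) by metis
    finally show ?thesis .
  qed
  fix A assume A: "A \<in> {A \<in> cop.span S. antihermitian A}"
  have "conj_map (op_exp (t *\<^sub>R A)) \<in> closed_channels S" for t
  proof (cases "0 \<le> t")
    case True
    then show ?thesis using A forward by blast
  next
    case False
    \<comment> \<open>The class supplies only nonnegative times; running \<open>- A\<close>, which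
      also lies in the span, for the time \<open>- t\<close> gives the rest.\<close>
    have "antihermitian (- A)" using A antihermitian_simps(2)[of A "-1"] by simp
    then show ?thesis using A False forward[of "- A" "- t"] cop.span_neg[of A S] by simp
  qed
  then show "A \<in> generators" using A by (simp add: generators_def)
qed

theorem theorem2p12:
  fixes S :: "'q::finite qubits_operator set" and first :: 'q
  assumes "adj ` S = S"
    and "hoermander_system S"
    and "on_factor first (ketbra 0 1) \<in> S"
    and "on_factor first pauli_Z \<in> S"
  shows "transitive_operations (closed_channels S)"
proof -
  note cc = channel_class_closed_channels[of S, unfolded channel_class_def]
  interpret closed_semigroup "closed_channels S" by (rule closed_semigroup_closed_channels)
  \<comment> \<open>The hull is the least real Lie algebra above the anti-Hermitian part of the
    span, and \<open>generators\<close> is one such algebra.\<close>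
  have "real_lie_algebra hull {A \<in> cop.span S. antihermitian A} \<subseteq> generators"
    by (intro hull_minimal span_subset_generators real_lie_algebra_generators)
  then have "special_unitary_algebra \<subseteq> generators"
    using assms(2) unfolding hoermander_system_def by blast
  then interpret qubit_channels "closed_channels S" first
    using cc assms(3,4) by unfold_locales (auto intro: antihermitian_mem_generators)
  show ?thesis
    unfolding transitive_operations_def
  proof (intro ballI disjI1)
    fix \<rho> \<sigma> :: "'q qubits_operator"
    assume "\<rho> \<in> states" "\<sigma> \<in> states"
    then show "\<exists>\<Phi>\<in>closed_channels S. \<Phi> \<rho> = \<sigma>"
      by (metis (mono_tags, lifting) reaches_state mem_Collect_eq states_def)
  qed
qed

end
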